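(* Let $n \ge d$ be positive integers and let $v_1, \dots, v_n \in \mathbb{R}^d$ be unit vectors. Suppose that \[ \lVert \varepsilon_1 v_1 + \dots + \varepsilon_n v_n \rVert \le \sqrt{2n-d} \quad \text{for every } \varepsilon_1, \dots, \varepsilon_n \in \{\pm 1\}. \] Then, after switching (that is, after replacing some of the vectors $v_i$ by $-v_i$), there is an orthogonal decomposition \[ \mathbb{R}^d = V_0 \oplus V_1 \oplus \dots \oplus V_{n-d} \] in which $V_1, \dots, V_{n-d}$ have positive even dimensions and $V_0$ is possibly zero dimensional, such that $v_1, \dots, v_n$ consist of an orthonormal basis of $V_0$ together with, for each $i \in \{1, \dots, n-d\}$, the vertices of a centered regular simplex inscribed in the unit sphere of $V_i$.
   Context: $\lVert\cdot\rVert$ denotes the Euclidean norm on $\mathbb{R}^d$. A centered regular simplex inscribed in the unit sphere of a $k$-dimensional subspace $V$ is a full-dimensional regular simplex in $V$: it has $k+1$ vertices, all of which are unit vectors in $V$, and its center is the origin (equivalently, distinct vertices have inner product $-1/k$). When $n=d$, there are no subspaces $V_i$ with $i\ge 1$ and $V_0=\mathbb{R}^d$. *)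

theory Defs
  imports "HOL-Analysis.Analysis"
begin

text \<open>Directness of the sum is not required separately: it follows from orthogonality.\<close>

definition orthogonal_decomposition :: "nat \<Rightarrow> (nat \<Rightarrow> 'a::euclidean_space set) \<Rightarrow> bool" where
  "orthogonal_decomposition m V \<longleftrightarrow>
     (\<forall>i\<le>m. subspace (V i)) \<and>
     (\<forall>i\<le>m. \<forall>j\<le>m. i \<noteq> j \<longrightarrow> (\<forall>x\<in>V i. \<forall>y\<in>V j. orthogonal x y)) \<and>
     (\<forall>x. \<exists>f. (\<forall>i\<le>m. f i \<in> V i) \<and> x = (\<Sum>i\<le>m. f i))"

definition orthonormal_basis_of :: "'a::euclidean_space set \<Rightarrow> 'a set \<Rightarrow> bool" where
  "orthonormal_basis_of V B \<longleftrightarrow>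
     pairwise orthogonal B \<and> (\<forall>x\<in>B. norm x = 1) \<and> span B = V"

text \<open>
  \<open>C\<close> is the vertex set of a full-dimensional regular simplex in the subspace \<open>V\<close>
  (affinely independent, \<open>dim V + 1\<close> vertices, all edges of the same length), with its
  vertices on the unit sphere and its barycentre at the origin.
\<close>

definition centered_regular_simplex_vertices :: "'a::euclidean_space set \<Rightarrow> 'a set \<Rightarrow> bool" where
  "centered_regular_simplex_vertices V C \<longleftrightarrow>
     finite C \<and> card C = dim V + 1 \<and> \<not> affine_dependent C \<and>
     C \<subseteq> V \<inter> sphere 0 1 \<and>
     (\<exists>l. \<forall>x\<in>C. \<forall>y\<in>C. x \<noteq> y \<longrightarrow> dist x y = l) \<and>
     (\<Sum>x\<in>C. x) = 0"

end

theory Submission imports Defs begin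

text \<open>
  Let \<open>S z = (\<Sum>i. (v i \<bullet> z) v i)\<close> be the frame operator, \<open>d\<close> the dimension, and \<open>K\<close> the set of all \<open>z\<close> with
  \<open>\<bar>v i \<bullet> z\<bar> \<le> 1\<close> for every \<open>i\<close>; through \<open>z \<mapsto> (v i \<bullet> z)\<^sub>i\<close> this is a section of the cube. Rounding the
  coordinates of a cube point \<open>t\<close> to signs one after the other does not decrease
  \<open>\<parallel>\<Sum>i. t i v i\<parallel>\<^sup>2 + (\<Sum>i. 1 - (t i)\<^sup>2)\<close>, because this expression is affine in each single coordinate
  (\<open>exists_signs_norm_ge\<close>). So the hypothesis on signed sums says that
  \<open>\<parallel>S z\<parallel>\<^sup>2 - z \<bullet> S z \<le> n - d\<close> for every \<open>z \<in> K\<close> (\<open>excess_le\<close>).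

  In an orthonormal eigenbasis of \<open>S\<close> with eigenvalues \<open>\<sigma> e\<close> the left-hand side is
  \<open>\<Sum>e. (\<sigma> e - 1) \<sigma> e (z \<bullet> e)\<^sup>2\<close>, while the trace gives \<open>(\<Sum>e. \<sigma> e - 1) = n - d\<close>. A point of \<open>K\<close> that
  reaches at least the sum of the positive \<open>\<sigma> e - 1\<close> is obtained by climbing down the eigenvalues: start at \<open>0\<close>,
  move inside the span of the eigenvectors with the largest eigenvalues to a vertex of the section
  of \<open>K\<close>, then allow the next eigenvalue, move to a vertex again, and so on. A vertex of a section by
  a \<open>k\<close>-dimensional subspace has at least \<open>k\<close> coordinates \<open>\<plusminus>1\<close>, so its squared coordinates sum to at
  least \<open>k\<close>; and the moves can be chosen so that the convex functionals involved do not decrease.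
  Summation by parts over the levels gives the claimed value (\<open>surplus_le\<close>). As the
  hypothesis forbids anything larger, all eigenvalues are at least \<open>1\<close> and no step can gain more
  than the minimum.

  This rigidity determines the configuration. Let \<open>E\<close> be the span of the eigenvectors with eigenvalue
  above \<open>1\<close>. Level by level it follows that every vertex of \<open>E \<inter> K\<close> has exactly \<open>dim E\<close> coordinates
  \<open>\<plusminus>1\<close> and all others \<open>0\<close> (\<open>tight_vertices\<close>). No rounding of the zero coordinates gains
  anything, which makes the vectors at these coordinates orthonormal and orthogonal to \<open>S z\<close>. Walking along an
  edge from one vertex must exchange one coordinate \<open>\<plusminus>1\<close> with one coordinate \<open>0\<close>, so that after
  switching \<open>E\<close> is spanned, in coordinates, by differences \<open>e\<^sub>i - e\<^sub>j\<close> of unit vectors. This partitions the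
  indices into blocks (\<open>exists_swap_star\<close>). Moving zeros around shows that vectors in
  different blocks are orthogonal (\<open>block_orthogonal\<close>) and that inside a block all
  inner products are equal to some \<open>- g < 0\<close> (\<open>fibre_inner\<close>). The sum of a block is then an
  eigenvector of \<open>S\<close> for a number below \<open>1\<close>, hence it vanishes and the block is a regular simplex
  (\<open>block_simplex\<close>). Each block has even dimension since the \<open>\<plusminus>1\<close> coordinates of a vertex in a block
  sum to \<open>0\<close>, and the value \<open>n - d\<close> of a vertex counts the blocks (\<open>card_centres\<close>).
\<close>

section \<open>Orthonormal eigenbases of self-adjoint maps\<close>

text \<open>
  First-order condition at the minimum \<open>t = 0\<close> of a quadratic polynomial.
\<close>
lemma linear_coeff_zero:
  fixes b c :: real
  assumes "\<And>t. 0 \<le> 2 * t * b + t\<^sup>2 * c"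
  shows "b = 0"
proof (rule ccontr)
  assume b: "b \<noteq> 0"
  \<comment> \<open>a step against the sign of \<open>b\<close>, short enough that the quadratic term cannot compensate\<close>
  define t where "t = - b / (\<bar>c\<bar> + 1)"
  have pos: "\<bar>c\<bar> + 1 > 0" by simp
  have tb: "t * (\<bar>c\<bar> + 1) = - b"
    using pos by (simp add: t_def)
  have "t\<^sup>2 * c \<le> t\<^sup>2 * (\<bar>c\<bar> + 1)"
    by (intro mult_left_mono) auto
  also have "\<dots> = - t * b"
    unfolding power2_eq_square mult.assoc tb by simp
  finally have "0 \<le> t * b"
    using assms[of t] by simp
  moreover have "t * b < 0"
    using b pos by (simp add: t_def divide_neg_pos power2_eq_square [symmetric])
  ultimately show False by simp
qed

text \<open>
  A maximiser of the Rayleigh quotient \<open>x \<bullet> f x\<close> on the unit sphere of the subspace is an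
  eigenvector: the quadratic form \<open>\<mu> (y \<bullet> y) - y \<bullet> f y\<close>, with \<open>\<mu>\<close> the maximum, is nonnegative and
  vanishes at the maximiser, so its derivative vanishes there as well.
\<close>
lemma eigenvector_in_invariant_subspace:
  fixes f :: "'a::euclidean_space \<Rightarrow> 'a"
  assumes f: "linear f" and sym: "\<And>x y. f x \<bullet> y = x \<bullet> f y"
    and W: "subspace W" and inv: "f ` W \<subseteq> W" and x0: "x0 \<in> W" "x0 \<noteq> 0"
  obtains e \<mu> where "e \<in> W" "norm e = 1" "f e = \<mu> *\<^sub>R e"
proof -
  define C where "C = sphere 0 1 \<inter> W"
  have "compact C"
    unfolding C_def by (intro compact_Int_closed compact_sphere closed_subspace W)
  moreover have "(1 / norm x0) *\<^sub>R x0 \<in> C"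
    using x0 W by (simp add: C_def subspace_scale)
  then have "C \<noteq> {}" by blast
  moreover have "continuous_on C (\<lambda>x. x \<bullet> f x)"
    using f by (intro continuous_intros linear_continuous_on) (simp add: linear_conv_bounded_linear)
  ultimately obtain e where e: "e \<in> C" and max: "\<And>y. y \<in> C \<Longrightarrow> y \<bullet> f y \<le> e \<bullet> f e"
    using continuous_attains_sup[of C "\<lambda>x. x \<bullet> f x"] by blast
  define \<mu> where "\<mu> = e \<bullet> f e"
  have eW: "e \<in> W" and ne: "norm e = 1" using e by (auto simp: C_def)
  have ee: "e \<bullet> e = 1" using ne by (simp add: norm_eq_1)
  have q: "0 \<le> \<mu> * (y \<bullet> y) - y \<bullet> f y" if "y \<in> W" for y
  proof (cases "y = 0")
    case True then show ?thesis using linear_0[OF f] by simp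
  next
    case False
    have "(1 / norm y) *\<^sub>R y \<in> C"
      using that False W by (simp add: C_def subspace_scale)
    then have "((1 / norm y) *\<^sub>R y) \<bullet> f ((1 / norm y) *\<^sub>R y) \<le> \<mu>"
      unfolding \<mu>_def by (rule max)
    moreover have "f ((1 / norm y) *\<^sub>R y) = (1 / norm y) *\<^sub>R f y"
      by (rule linear_cmul[OF f])
    ultimately have "(y \<bullet> f y) / (norm y)\<^sup>2 \<le> \<mu>"
      by (simp add: power2_eq_square)
    then show ?thesis
      using False by (simp add: divide_le_eq power2_norm_eq_inner)
  qed
  define y where "y = f e - \<mu> *\<^sub>R e"
  have yW: "y \<in> W"
    using eW inv W by (auto simp: y_def intro!: subspace_diff subspace_scale)
  have "(\<mu> *\<^sub>R e - f e) \<bullet> y = 0"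
  proof (rule linear_coeff_zero)
    fix t :: real
    have "e + t *\<^sub>R y \<in> W" using eW yW W by (simp add: subspace_add subspace_scale)
    from q[OF this] show "0 \<le> 2 * t * ((\<mu> *\<^sub>R e - f e) \<bullet> y) + t\<^sup>2 * (\<mu> * (y \<bullet> y) - y \<bullet> f y)"
      using f sym[of e y] ee
      by (simp add: linear_add linear_scale inner_simps inner_commute algebra_simps
          power2_eq_square \<mu>_def)
  qed
  then have "- (y \<bullet> y) = 0"
    by (simp add: y_def inner_diff_left)
  then have "f e = \<mu> *\<^sub>R e" by (simp add: y_def)
  with eW ne that show thesis by blast
qed

text \<open>
  The orthogonal complement of an eigenvector is again invariant, so eigenvectors can be
  split off one at a time.
\<close>
theorem self_adjoint_orthonormal_eigenbasis_subspace:
  fixes f :: "'a::euclidean_space \<Rightarrow> 'a"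
  assumes f: "linear f" and sym: "\<And>x y. f x \<bullet> y = x \<bullet> f y"
  shows "subspace W \<Longrightarrow> f ` W \<subseteq> W \<Longrightarrow>
    \<exists>B \<sigma>. B \<subseteq> W \<and> pairwise orthogonal B \<and> (\<forall>e\<in>B. norm e = 1) \<and> W \<subseteq> span B \<and>
      (\<forall>e\<in>B. f e = \<sigma> e *\<^sub>R e)"
proof (induction "dim W" arbitrary: W rule: less_induct)
  case less
  note W = less.prems(1) and inv = less.prems(2)
  show ?case
  proof (cases "W \<subseteq> {0}")
    case True
    then show ?thesis by (intro exI[of _ "{}"]) auto
  next
    case False
    then obtain x0 where x0: "x0 \<in> W" "x0 \<noteq> 0" by auto
    obtain e \<mu> where e: "e \<in> W" "norm e = 1" "f e = \<mu> *\<^sub>R e"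
      using eigenvector_in_invariant_subspace[OF f sym W inv x0] by blast
    have ee: "e \<bullet> e = 1" using e(2) by (simp add: norm_eq_1)
    define W' where "W' = {x \<in> W. e \<bullet> x = 0}"
    have W': "subspace W'"
      unfolding W'_def using W by (auto simp: subspace_def inner_simps)
    have inv': "f ` W' \<subseteq> W'"
    proof -
      have "e \<bullet> f x = 0" if "x \<in> W'" for x
        using sym[of e x] e(3) that by (simp add: W'_def)
      then show ?thesis using inv by (auto simp: W'_def)
    qed
    have "dim W' < dim W"
    proof (rule dim_psubset)
      have "e \<notin> W'" using ee by (simp add: W'_def)
      then have "W' \<subset> W" using e(1) unfolding W'_def by blast
      then show "span W' \<subset> span W" using W W' by (metis span_eq_iff)
    qed
    from less.hyps[OF this W' inv'] obtain B \<sigma> where B: "B \<subseteq> W'" "pairwise orthogonal B"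
      "\<And>b. b \<in> B \<Longrightarrow> norm b = 1" "W' \<subseteq> span B" "\<And>b. b \<in> B \<Longrightarrow> f b = \<sigma> b *\<^sub>R b"
      by blast
    have eB: "e \<notin> B" using B(1) ee by (auto simp: W'_def)
    have "W \<subseteq> span (insert e B)"
    proof
      fix x assume x: "x \<in> W"
      have "x - (e \<bullet> x) *\<^sub>R e \<in> W'"
        using x e(1) ee W by (simp add: W'_def subspace_diff subspace_scale inner_simps)
      then show "x \<in> span (insert e B)"
        using B(4) by (auto simp: span_insert)
    qed
    moreover have "pairwise orthogonal (insert e B)"
      using B(1,2) by (auto simp: pairwise_insert W'_def orthogonal_def inner_commute)
    ultimately show ?thesis
      using B e eB
      by (intro exI[of _ "insert e B"] exI[of _ "\<sigma>(e := \<mu>)"]) (auto simp: W'_def)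
  qed
qed

section \<open>Rounding points of the cube to signs\<close>

text \<open>
  If the coordinates were rounded independently at random to signs with means \<open>t i\<close>, equality would hold
  in expectation. The signs are chosen one at a time, which is why a translation \<open>u\<close> is
  carried along for the induction.
\<close>
lemma exists_signs_norm_ge:
  fixes v :: "'i \<Rightarrow> 'a::real_inner" and t :: "'i \<Rightarrow> real"
  assumes "finite N" and "\<And>i. i \<in> N \<Longrightarrow> \<bar>t i\<bar> \<le> 1"
  shows "\<exists>\<epsilon>. (\<forall>i\<in>N. \<epsilon> i \<in> {-1, 1}) \<and>
    (norm (u + (\<Sum>i\<in>N. t i *\<^sub>R v i)))\<^sup>2 + (\<Sum>i\<in>N. (1 - (t i)\<^sup>2) * (norm (v i))\<^sup>2)
      \<le> (norm (u + (\<Sum>i\<in>N. \<epsilon> i *\<^sub>R v i)))\<^sup>2"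
  using assms
proof (induction N arbitrary: u rule: finite_induct)
  case empty
  then show ?case by simp
next
  case (insert j N)
  obtain \<epsilon> :: "'i \<Rightarrow> real" where \<epsilon>: "\<forall>i\<in>N. \<epsilon> i \<in> {-1, 1}"
    and le: "(norm ((u + t j *\<^sub>R v j) + (\<Sum>i\<in>N. t i *\<^sub>R v i)))\<^sup>2 + (\<Sum>i\<in>N. (1 - (t i)\<^sup>2) * (norm (v i))\<^sup>2)
      \<le> (norm ((u + t j *\<^sub>R v j) + (\<Sum>i\<in>N. \<epsilon> i *\<^sub>R v i)))\<^sup>2"
    using insert.IH[of "u + t j *\<^sub>R v j"] insert.prems by auto
  define a where "a = u + (\<Sum>i\<in>N. \<epsilon> i *\<^sub>R v i)"
  define s :: real where "s = (if a \<bullet> v j \<ge> 0 then 1 else -1)"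
  have sq: "(norm (a + c *\<^sub>R v j))\<^sup>2 = (norm a)\<^sup>2 + 2 * c * (a \<bullet> v j) + c\<^sup>2 * (norm (v j))\<^sup>2" for c
    unfolding power2_norm_eq_inner
    by (simp add: inner_simps inner_commute power2_eq_square algebra_simps)
  have "t j * (a \<bullet> v j) \<le> \<bar>t j * (a \<bullet> v j)\<bar>" by simp
  also have "\<dots> \<le> 1 * \<bar>a \<bullet> v j\<bar>"
    unfolding abs_mult using insert.prems by (intro mult_right_mono) auto
  also have "\<dots> = s * (a \<bullet> v j)" by (simp add: s_def)
  finally have lin: "t j * (a \<bullet> v j) \<le> s * (a \<bullet> v j)" .
  have eq1: "(u + t j *\<^sub>R v j) + (\<Sum>i\<in>N. \<epsilon> i *\<^sub>R v i) = a + t j *\<^sub>R v j"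
    by (simp add: a_def algebra_simps)
  have eq2: "(\<Sum>i\<in>N. (\<epsilon>(j := s)) i *\<^sub>R v i) = (\<Sum>i\<in>N. \<epsilon> i *\<^sub>R v i)"
    using insert.hyps by (intro sum.cong) auto
  have "(norm (a + t j *\<^sub>R v j))\<^sup>2 + (1 - (t j)\<^sup>2) * (norm (v j))\<^sup>2 \<le> (norm (a + s *\<^sub>R v j))\<^sup>2"
    using lin unfolding sq by (auto simp: s_def algebra_simps)
  moreover have "a + s *\<^sub>R v j = u + (\<Sum>i\<in>insert j N. (\<epsilon>(j := s)) i *\<^sub>R v i)"
    using insert.hyps eq2 by (simp add: a_def algebra_simps)
  ultimately have h1: "(norm (a + t j *\<^sub>R v j))\<^sup>2 + (1 - (t j)\<^sup>2) * (norm (v j))\<^sup>2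
      \<le> (norm (u + (\<Sum>i\<in>insert j N. (\<epsilon>(j := s)) i *\<^sub>R v i)))\<^sup>2" by simp
  have h2: "u + (\<Sum>i\<in>insert j N. t i *\<^sub>R v i) = (u + t j *\<^sub>R v j) + (\<Sum>i\<in>N. t i *\<^sub>R v i)"
    using insert.hyps by (simp add: algebra_simps)
  have h3: "(\<Sum>i\<in>insert j N. (1 - (t i)\<^sup>2) * (norm (v i))\<^sup>2)
      = (1 - (t j)\<^sup>2) * (norm (v j))\<^sup>2 + (\<Sum>i\<in>N. (1 - (t i)\<^sup>2) * (norm (v i))\<^sup>2)"
    using insert.hyps by simp
  show ?case
  proof (intro exI conjI)
    show "\<forall>i\<in>insert j N. (\<epsilon>(j := s)) i \<in> {-1, 1}"
      using \<epsilon> by (simp add: s_def)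
    show "(norm (u + (\<Sum>i\<in>insert j N. t i *\<^sub>R v i)))\<^sup>2 + (\<Sum>i\<in>insert j N. (1 - (t i)\<^sup>2) * (norm (v i))\<^sup>2)
      \<le> (norm (u + (\<Sum>i\<in>insert j N. (\<epsilon>(j := s)) i *\<^sub>R v i)))\<^sup>2"
      unfolding h2 h3 using order_trans[OF add_right_mono[OF le[unfolded eq1], of "(1 - (t j)\<^sup>2) * (norm (v j))\<^sup>2"] h1]
      by (simp only: add.assoc add.commute add.left_commute)
  qed
qed


section \<open>Sections of the symmetric slab body and their vertices\<close>

locale vector_family =
  fixes v :: "'i \<Rightarrow> 'a::euclidean_space" and N :: "'i set"
  assumes finite_N: "finite N"
begin

definition frame_op :: "'a \<Rightarrow> 'a" where
  "frame_op z = (\<Sum>i\<in>N. (v i \<bullet> z) *\<^sub>R v i)"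

definition slab_body :: "'a set" where
  "slab_body = {z. \<forall>i\<in>N. \<bar>v i \<bullet> z\<bar> \<le> 1}"

definition active :: "'a \<Rightarrow> 'i set" where
  "active z = {i \<in> N. \<bar>v i \<bullet> z\<bar> = 1}"

text \<open>
  These are the extreme points of the polytope \<open>L \<inter> slab_body\<close>: no line in \<open>L\<close> through \<open>z\<close> keeps all tight
  constraints tight.
\<close>
definition section_vertex :: "'a set \<Rightarrow> 'a \<Rightarrow> bool" where
  "section_vertex L z \<longleftrightarrow> z \<in> L \<and> z \<in> slab_body \<and>
     (\<forall>y\<in>L. (\<forall>i\<in>active z. v i \<bullet> y = 0) \<longrightarrow> y = 0)"

lemma linear_frame_op: "linear frame_op"
  unfolding frame_op_def
  by (rule linearI) (simp_all add: inner_simps scaleR_add_left sum.distrib scaleR_sum_right)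

lemmas frame_op_add = linear_add[OF linear_frame_op]
  and frame_op_diff = linear_diff[OF linear_frame_op]
  and frame_op_scale = linear_cmul[OF linear_frame_op]

lemma inner_frame_op: "x \<bullet> frame_op y = (\<Sum>i\<in>N. (v i \<bullet> x) * (v i \<bullet> y))"
  by (simp add: frame_op_def inner_sum_right inner_commute mult.commute)

lemma frame_op_self_adjoint: "frame_op x \<bullet> y = x \<bullet> frame_op y"
  by (metis (no_types, lifting) inner_commute inner_frame_op mult.commute sum.cong)

lemma inner_frame_op_self: "z \<bullet> frame_op z = (\<Sum>i\<in>N. (v i \<bullet> z)\<^sup>2)"
  by (simp add: inner_frame_op power2_eq_square)

lemma finite_active [simp]: "finite (active z)"
  using finite_N by (simp add: active_def)

lemma active_subset: "active z \<subseteq> N"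
  by (auto simp: active_def)

text \<open>
  Each linear equation lowers the dimension by at most one.
\<close>
lemma dim_le_dim_kernel_plus_card:
  assumes L: "subspace L" and "finite A"
  shows "dim L \<le> dim {y \<in> L. \<forall>i\<in>A. v i \<bullet> y = 0} + card A"
proof -
  define W where "W = {y. \<forall>x\<in>span (v ` A). orthogonal x y}"
  have W: "subspace W"
    unfolding W_def by (auto simp: subspace_def orthogonal_def inner_simps)
  have "dim W + dim (span (v ` A)) = dim (UNIV :: 'a set)"
    using dim_subspace_orthogonal_to_vectors[of "span (v ` A)" UNIV] by (simp add: W_def)
  moreover have "dim (span (v ` A)) \<le> card A"
    using assms(2) by (metis card_image_le dim_le_card' dim_span finite_imageI le_trans)
  moreover have "dim {x + y |x y. x \<in> L \<and> y \<in> W} + dim (L \<inter> W) = dim L + dim W"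
    using dim_sums_Int[OF L W] .
  moreover have "dim {x + y |x y. x \<in> L \<and> y \<in> W} \<le> dim (UNIV :: 'a set)"
    by (simp add: dim_subset_UNIV)
  ultimately have "dim L \<le> dim (L \<inter> W) + card A" by linarith
  moreover have "L \<inter> W \<subseteq> {y \<in> L. \<forall>i\<in>A. v i \<bullet> y = 0}"
    by (auto simp: W_def orthogonal_def intro: span_base)
  then have "dim (L \<inter> W) \<le> dim {y \<in> L. \<forall>i\<in>A. v i \<bullet> y = 0}"
    by (rule dim_subset)
  ultimately show ?thesis by linarith
qed

lemma section_vertex_dim_le:
  assumes "subspace L" "section_vertex L z"
  shows "dim L \<le> card (active z)"
proof -
  have "{y \<in> L. \<forall>i\<in>active z. v i \<bullet> y = 0} \<subseteq> {0}"
    using assms(2) by (auto simp: section_vertex_def)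
  then have "dim {y \<in> L. \<forall>i\<in>active z. v i \<bullet> y = 0} = 0"
    by (simp only: dim_eq_0)
  then show ?thesis
    using dim_le_dim_kernel_plus_card[OF assms(1) finite_active, of z] by linarith
qed

lemma slab_body_two_sided_step:
  assumes z: "z \<in> slab_body" and y: "\<And>i. i \<in> active z \<Longrightarrow> v i \<bullet> y = 0"
  obtains \<delta> where "\<delta> > 0" "z + \<delta> *\<^sub>R y \<in> slab_body" "z - \<delta> *\<^sub>R y \<in> slab_body"
proof -
  define m where "m i = (1 - \<bar>v i \<bullet> z\<bar>) / (\<bar>v i \<bullet> y\<bar> + 1)" for i
  define \<delta> where "\<delta> = Min (insert 1 (m ` (N - active z)))"
  have fin: "finite (insert 1 (m ` (N - active z)))" using finite_N by simp
  have lt: "\<bar>v i \<bullet> z\<bar> < 1" if "i \<in> N - active z" for i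
    using z that by (force simp: slab_body_def active_def)
  have "m i > 0" if "i \<in> N - active z" for i
    unfolding m_def using lt[OF that] by (intro divide_pos_pos) linarith+
  then have pos: "\<delta> > 0"
    unfolding \<delta>_def using fin by (subst Min_gr_iff) auto
  have key: "\<bar>v i \<bullet> z\<bar> + \<delta> * \<bar>v i \<bullet> y\<bar> \<le> 1" if i: "i \<in> N" for i
  proof (cases "i \<in> active z")
    case True
    then show ?thesis using y z i by (simp add: slab_body_def)
  next
    case False
    have "\<delta> \<le> m i" unfolding \<delta>_def using fin i False by (intro Min_le) auto
    then have "\<delta> * (\<bar>v i \<bullet> y\<bar> + 1) \<le> 1 - \<bar>v i \<bullet> z\<bar>"
      unfolding m_def by (subst (asm) pos_le_divide_eq) auto
    then show ?thesis using pos by (simp add: algebra_simps)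
  qed
  have "z + \<delta> *\<^sub>R y \<in> slab_body" "z - \<delta> *\<^sub>R y \<in> slab_body"
    unfolding slab_body_def
  proof (safe)
    fix i assume i: "i \<in> N"
    have "\<bar>\<delta> * (v i \<bullet> y)\<bar> = \<delta> * \<bar>v i \<bullet> y\<bar>" using pos by (simp add: abs_mult)
    with key[OF i] show "\<bar>v i \<bullet> (z + \<delta> *\<^sub>R y)\<bar> \<le> 1" "\<bar>v i \<bullet> (z - \<delta> *\<^sub>R y)\<bar> \<le> 1"
      by (simp_all add: inner_simps)
  qed
  with pos that show thesis by blast
qed

lemma slab_body_maximal_step:
  assumes z: "z \<in> slab_body" and y: "\<And>i. i \<in> active z \<Longrightarrow> v i \<bullet> y = 0"
    and j: "j \<in> N" "v j \<bullet> y \<noteq> 0"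
  obtains \<tau> where "\<tau> \<ge> 0" "z + \<tau> *\<^sub>R y \<in> slab_body" "active z \<subset> active (z + \<tau> *\<^sub>R y)"
proof -
  define M where "M = {i \<in> N. v i \<bullet> y \<noteq> 0}"
  \<comment> \<open>the time at which the \<open>i\<close>-th constraint becomes tight in the direction \<open>y\<close>\<close>
  define m where "m i = (1 - sgn (v i \<bullet> y) * (v i \<bullet> z)) / \<bar>v i \<bullet> y\<bar>" for i
  define \<tau> where "\<tau> = Min (m ` M)"
  have fin: "finite (m ` M)" and ne: "m ` M \<noteq> {}"
    using finite_N j by (auto simp: M_def)
  have m0: "m i \<ge> 0" if "i \<in> M" for i
  proof -
    have "\<bar>v i \<bullet> z\<bar> \<le> 1" using z that by (simp add: slab_body_def M_def)
    then show ?thesis by (auto simp: m_def sgn_real_def intro!: divide_nonneg_nonneg)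
  qed
  then have tau0: "\<tau> \<ge> 0" unfolding \<tau>_def using fin ne by simp
  have le: "\<bar>v i \<bullet> (z + \<tau> *\<^sub>R y)\<bar> \<le> 1" if i: "i \<in> N" for i
  proof (cases "v i \<bullet> y = 0")
    case True
    then show ?thesis using z i by (simp add: slab_body_def inner_simps)
  next
    case False
    then have "\<tau> \<le> m i" unfolding \<tau>_def using fin i by (intro Min_le) (auto simp: M_def)
    then have "\<tau> * \<bar>v i \<bullet> y\<bar> \<le> 1 - sgn (v i \<bullet> y) * (v i \<bullet> z)"
      using False by (simp add: m_def pos_le_divide_eq)
    moreover have "\<tau> * \<bar>v i \<bullet> y\<bar> \<ge> 0" using tau0 by simp
    moreover have "\<bar>v i \<bullet> z\<bar> \<le> 1" using z i by (simp add: slab_body_def)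
    ultimately show ?thesis
      using False by (cases "v i \<bullet> y > 0") (auto simp: inner_simps sgn_real_def abs_le_iff)
  qed
  obtain i where i: "i \<in> M" "\<tau> = m i"
    using Min_in[OF fin ne] by (auto simp: \<tau>_def)
  have "\<tau> * \<bar>v i \<bullet> y\<bar> = 1 - sgn (v i \<bullet> y) * (v i \<bullet> z)"
    using i by (simp add: m_def M_def)
  then have "\<bar>v i \<bullet> (z + \<tau> *\<^sub>R y)\<bar> = 1"
    using i by (cases "v i \<bullet> y > 0") (auto simp: inner_simps sgn_real_def M_def)
  then have "i \<in> active (z + \<tau> *\<^sub>R y)" using i by (simp add: active_def M_def)
  moreover have "i \<notin> active z" using y[of i] i by (auto simp: M_def)
  moreover have "active z \<subseteq> active (z + \<tau> *\<^sub>R y)"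
    using y by (auto simp: active_def inner_simps)
  ultimately show thesis
    using that[OF tau0] le by (auto simp: slab_body_def)
qed

text \<open>
  From a point that is not a vertex one can move along a line without losing tight
  constraints. A positive semidefinite quadratic form is convex, so one of the two directions does
  not decrease it, and going in this direction as far as possible makes a new constraint tight.
\<close>
lemma section_vertex_exists:
  assumes L: "subspace L" and inj: "\<And>y. y \<in> L \<Longrightarrow> (\<And>i. i \<in> N \<Longrightarrow> v i \<bullet> y = 0) \<Longrightarrow> y = 0"
    and c: "\<And>e. e \<in> X \<Longrightarrow> (0::real) \<le> c e"
  shows "z \<in> L \<Longrightarrow> z \<in> slab_body \<Longrightarrow>
    \<exists>z'. section_vertex L z' \<and> (\<Sum>e\<in>X. c e * (z \<bullet> e)\<^sup>2) \<le> (\<Sum>e\<in>X. c e * (z' \<bullet> e)\<^sup>2)"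
proof (induction "card (N - active z)" arbitrary: z rule: less_induct)
  case less
  show ?case
  proof (cases "section_vertex L z")
    case True
    then show ?thesis by blast
  next
    case False
    then obtain y' where y': "y' \<in> L" "y' \<noteq> 0" "\<And>i. i \<in> active z \<Longrightarrow> v i \<bullet> y' = 0"
      using less.prems unfolding section_vertex_def by blast
    define s :: real where "s = (if (\<Sum>e\<in>X. c e * ((z \<bullet> e) * (y' \<bullet> e))) \<ge> 0 then 1 else -1)"
    define y where "y = s *\<^sub>R y'"
    have y: "y \<in> L" "\<And>i. i \<in> active z \<Longrightarrow> v i \<bullet> y = 0" and s0: "s \<noteq> 0"
      using y' L by (simp_all add: y_def s_def subspace_scale)
    have cross: "(\<Sum>e\<in>X. c e * ((z \<bullet> e) * (y \<bullet> e))) \<ge> 0"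
    proof -
      have "(\<Sum>e\<in>X. c e * ((z \<bullet> e) * (y \<bullet> e))) = s * (\<Sum>e\<in>X. c e * ((z \<bullet> e) * (y' \<bullet> e)))"
        by (simp add: y_def sum_distrib_left algebra_simps)
      then show ?thesis by (simp add: s_def)
    qed
    obtain j where "j \<in> N" "v j \<bullet> y \<noteq> 0"
      using inj[OF y'(1)] y'(2) s0 by (auto simp: y_def)
    then obtain \<tau> where \<tau>: "\<tau> \<ge> 0" "z + \<tau> *\<^sub>R y \<in> slab_body" "active z \<subset> active (z + \<tau> *\<^sub>R y)"
      using slab_body_maximal_step[OF less.prems(2) y(2)] by metis
    have "N - active (z + \<tau> *\<^sub>R y) \<subset> N - active z"
      using \<tau>(3) active_subset[of "z + \<tau> *\<^sub>R y"] by blast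
    then have "card (N - active (z + \<tau> *\<^sub>R y)) < card (N - active z)"
      using finite_N by (simp add: psubset_card_mono)
    moreover have "z + \<tau> *\<^sub>R y \<in> L"
      using less.prems(1) y L by (simp add: subspace_add subspace_scale)
    ultimately obtain z' where z': "section_vertex L z'"
      "(\<Sum>e\<in>X. c e * ((z + \<tau> *\<^sub>R y) \<bullet> e)\<^sup>2) \<le> (\<Sum>e\<in>X. c e * (z' \<bullet> e)\<^sup>2)"
      using less.hyps \<tau>(2) by blast
    have "(\<Sum>e\<in>X. c e * ((z + \<tau> *\<^sub>R y) \<bullet> e)\<^sup>2) =
      (\<Sum>e\<in>X. c e * (z \<bullet> e)\<^sup>2) + 2 * \<tau> * (\<Sum>e\<in>X. c e * ((z \<bullet> e) * (y \<bullet> e)))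
        + \<tau>\<^sup>2 * (\<Sum>e\<in>X. c e * (y \<bullet> e)\<^sup>2)"
      by (simp add: sum_distrib_left sum.distrib[symmetric] inner_simps power2_eq_square algebra_simps)
    moreover have "(\<Sum>e\<in>X. c e * (y \<bullet> e)\<^sup>2) \<ge> 0"
      using c by (simp add: sum_nonneg)
    ultimately have "(\<Sum>e\<in>X. c e * (z \<bullet> e)\<^sup>2) \<le> (\<Sum>e\<in>X. c e * ((z + \<tau> *\<^sub>R y) \<bullet> e)\<^sup>2)"
      using cross \<tau>(1) by simp
    with z' show ?thesis by (meson order_trans)
  qed
qed

end


section \<open>The signed-sum bound as a bound on the slab body\<close>

context vector_family begin

lemma sum_active: "(\<Sum>i\<in>active z. (v i \<bullet> z)\<^sup>2) = real (card (active z))"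
proof -
  have "(v i \<bullet> z)\<^sup>2 = 1" if "i \<in> active z" for i
    using that by (metis (mono_tags, lifting) active_def mem_Collect_eq one_power2 power2_abs)
  then show ?thesis by simp
qed

lemma card_active_le:
  assumes "z \<in> slab_body"
  shows "real (card (active z)) \<le> (\<Sum>i\<in>N. (v i \<bullet> z)\<^sup>2)"
proof -
  have "real (card (active z)) = (\<Sum>i\<in>active z. (v i \<bullet> z)\<^sup>2)"
    by (simp add: sum_active)
  also have "\<dots> \<le> (\<Sum>i\<in>N. (v i \<bullet> z)\<^sup>2)"
    using finite_N active_subset by (intro sum_mono2) auto
  finally show ?thesis .
qed

lemma inactive_coords_zero:
  assumes "(\<Sum>i\<in>N. (v i \<bullet> z)\<^sup>2) \<le> real (card (active z))" and "i \<in> N - active z"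
  shows "v i \<bullet> z = 0"
proof -
  note sum_active[of z]
  moreover have "(\<Sum>i\<in>N. (v i \<bullet> z)\<^sup>2) = (\<Sum>i\<in>active z. (v i \<bullet> z)\<^sup>2) + (\<Sum>i\<in>N - active z. (v i \<bullet> z)\<^sup>2)"
    using finite_N active_subset by (metis add.commute sum.subset_diff)
  ultimately have "(\<Sum>i\<in>N - active z. (v i \<bullet> z)\<^sup>2) \<le> 0" using assms(1) by linarith
  moreover have "(v i \<bullet> z)\<^sup>2 \<le> (\<Sum>i\<in>N - active z. (v i \<bullet> z)\<^sup>2)"
    using assms(2) finite_N by (intro member_le_sum) auto
  ultimately have "(v i \<bullet> z)\<^sup>2 \<le> 0" by linarith
  then show ?thesis by simp
qed

end

locale bounded_signed_sums = vector_family v N for v :: "'i \<Rightarrow> 'a::euclidean_space" and N +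
  assumes unit: "\<And>i. i \<in> N \<Longrightarrow> norm (v i) = 1"
    and signed_sum_le: "\<And>\<epsilon>. (\<forall>i\<in>N. \<epsilon> i \<in> {-1, 1::real}) \<Longrightarrow>
      (norm (\<Sum>i\<in>N. \<epsilon> i *\<^sub>R v i))\<^sup>2 \<le> 2 * real (card N) - real (DIM('a))"
begin

lemma cube_point_le:
  assumes "\<And>i. i \<in> N \<Longrightarrow> \<bar>t i\<bar> \<le> 1"
  shows "(norm (\<Sum>i\<in>N. t i *\<^sub>R v i))\<^sup>2 + (\<Sum>i\<in>N. 1 - (t i)\<^sup>2) \<le> 2 * real (card N) - real (DIM('a))"
proof -
  obtain \<epsilon> :: "'i \<Rightarrow> real" where \<epsilon>: "\<forall>i\<in>N. \<epsilon> i \<in> {-1, 1}"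
    and le: "(norm (0 + (\<Sum>i\<in>N. t i *\<^sub>R v i)))\<^sup>2 + (\<Sum>i\<in>N. (1 - (t i)\<^sup>2) * (norm (v i))\<^sup>2)
      \<le> (norm (0 + (\<Sum>i\<in>N. \<epsilon> i *\<^sub>R v i)))\<^sup>2"
    using exists_signs_norm_ge[where u = 0 and v = v and t = t, OF finite_N assms] by blast
  then show ?thesis
    using signed_sum_le[OF \<epsilon>] unit by simp
qed

lemma excess_le:
  assumes "z \<in> slab_body"
  shows "(norm (frame_op z))\<^sup>2 - z \<bullet> frame_op z \<le> real (card N) - real (DIM('a))"
  using cube_point_le[of "\<lambda>i. v i \<bullet> z"] assms
  by (simp add: slab_body_def frame_op_def[symmetric] inner_frame_op_self sum_subtractf)

end

section \<open>Descending through the eigenvalues\<close>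

locale bounded_signed_sums_eigen = bounded_signed_sums v N
  for v :: "'i \<Rightarrow> 'a::euclidean_space" and N +
  fixes B :: "'a set" and \<sigma> :: "'a \<Rightarrow> real"
  assumes B_orthogonal: "pairwise orthogonal B"
    and B_unit: "\<And>e. e \<in> B \<Longrightarrow> norm e = 1"
    and B_span: "span B = UNIV"
    and eigen: "\<And>e. e \<in> B \<Longrightarrow> frame_op e = \<sigma> e *\<^sub>R e"
begin

lemma B_inner: "e \<in> B \<Longrightarrow> e' \<in> B \<Longrightarrow> e \<bullet> e' = (if e = e' then 1 else 0)"
  using B_orthogonal B_unit by (auto simp: pairwise_def orthogonal_def norm_eq_1)

lemma B_independent: "independent B"
  using B_orthogonal B_unit by (intro pairwise_orthogonal_independent) force+

lemma finite_B [simp]: "finite B"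
  using B_independent by (rule independent_imp_finite)

lemma card_B: "card B = DIM('a)"
  using dim_eq_card_independent[OF B_independent] dim_span[of B] by (simp add: B_span)

lemma B_expand: "(\<Sum>e\<in>B. (z \<bullet> e) *\<^sub>R e) = z"
  using orthonormal_basis_expand[OF B_orthogonal B_unit _ finite_B, of z] B_span by simp

lemma inner_B_expand: "x \<bullet> y = (\<Sum>e\<in>B. (x \<bullet> e) * (y \<bullet> e))"
proof -
  have "x \<bullet> y = (\<Sum>e\<in>B. (x \<bullet> e) *\<^sub>R e) \<bullet> y" by (simp only: B_expand)
  also have "\<dots> = (\<Sum>e\<in>B. (x \<bullet> e) * (y \<bullet> e))"
    unfolding inner_sum_left inner_scaleR_left by (intro sum.cong refl) (simp add: inner_commute)
  finally show ?thesis .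
qed

lemma frame_op_inner_B: "e \<in> B \<Longrightarrow> frame_op z \<bullet> e = \<sigma> e * (z \<bullet> e)"
  by (simp add: frame_op_self_adjoint eigen)

lemma sum_coords_B: "(\<Sum>i\<in>N. (v i \<bullet> z)\<^sup>2) = (\<Sum>e\<in>B. \<sigma> e * (z \<bullet> e)\<^sup>2)"
  unfolding inner_frame_op_self[symmetric]
  by (subst inner_B_expand) (auto intro!: sum.cong simp: frame_op_inner_B power2_eq_square)

lemma norm_frame_op_B: "(norm (frame_op z))\<^sup>2 = (\<Sum>e\<in>B. (\<sigma> e)\<^sup>2 * (z \<bullet> e)\<^sup>2)"
  unfolding power2_norm_eq_inner
  by (subst inner_B_expand) (auto intro!: sum.cong simp: frame_op_inner_B power2_eq_square)

lemma sum_eigenvalues: "(\<Sum>e\<in>B. \<sigma> e) = real (card N)"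
proof -
  have "\<sigma> e = (\<Sum>i\<in>N. (v i \<bullet> e)\<^sup>2)" if "e \<in> B" for e
    using that by (simp add: inner_frame_op_self[symmetric] eigen B_inner)
  then have "(\<Sum>e\<in>B. \<sigma> e) = (\<Sum>e\<in>B. \<Sum>i\<in>N. (v i \<bullet> e)\<^sup>2)" by simp
  also have "\<dots> = (\<Sum>i\<in>N. \<Sum>e\<in>B. (v i \<bullet> e) * (v i \<bullet> e))"
    by (subst sum.swap) (simp add: power2_eq_square)
  also have "\<dots> = (\<Sum>i\<in>N. v i \<bullet> v i)"
    by (simp add: inner_B_expand[symmetric])
  also have "\<dots> = real (card N)"
    using unit by (simp add: norm_eq_1)
  finally show ?thesis .
qed

definition eigensum :: "'a set \<Rightarrow> 'a set" where
  "eigensum X = {z. \<forall>e\<in>B - X. z \<bullet> e = 0}"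

lemma subspace_eigensum [simp]: "subspace (eigensum X)"
  by (auto simp: eigensum_def subspace_def inner_simps)

lemma eigensum_mono: "X \<subseteq> Y \<Longrightarrow> eigensum X \<subseteq> eigensum Y"
  by (auto simp: eigensum_def)

lemma eigensumD: "z \<in> eigensum X \<Longrightarrow> e \<in> B \<Longrightarrow> e \<notin> X \<Longrightarrow> z \<bullet> e = 0"
  by (simp add: eigensum_def)

lemma dim_eigensum: "X \<subseteq> B \<Longrightarrow> dim (eigensum X) = card X"
proof -
  assume X: "X \<subseteq> B"
  have "eigensum X = span X"
  proof
    show "eigensum X \<subseteq> span X"
    proof
      fix z assume z: "z \<in> eigensum X"
      have "z = (\<Sum>e\<in>B. (z \<bullet> e) *\<^sub>R e)" by (simp add: B_expand)
      also have "\<dots> = (\<Sum>e\<in>X. (z \<bullet> e) *\<^sub>R e)"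
        using X z by (intro sum.mono_neutral_right) (auto dest: eigensumD)
      also have "\<dots> \<in> span X" by (intro span_sum span_scale span_base)
      finally show "z \<in> span X" .
    qed
    have "X \<subseteq> eigensum X" using X B_inner by (auto simp: eigensum_def)
    then show "span X \<subseteq> eigensum X" by (simp add: span_minimal)
  qed
  moreover have "independent X" using B_independent X by (rule independent_mono)
  ultimately show ?thesis by (simp add: dim_eq_card_independent)
qed

lemma sum_eigensum:
  assumes "z \<in> eigensum X" "X \<subseteq> B" "\<And>e. e \<in> B \<Longrightarrow> z \<bullet> e = 0 \<Longrightarrow> g e = 0"
  shows "(\<Sum>e\<in>B. g e) = (\<Sum>e\<in>X. g e)"
  using assms by (intro sum.mono_neutral_right) (auto dest: eigensumD)

text \<open>
  On eigenvectors with positive eigenvalues the coordinate map \<open>z \<mapsto> (v i \<bullet> z)\<^sub>i\<close> is injective, which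
  makes the corresponding section of the slab body bounded and provides it with vertices.
\<close>
lemma eigensum_coords_inj:
  assumes "y \<in> eigensum X" "\<And>e. e \<in> X \<Longrightarrow> \<sigma> e > 0" "X \<subseteq> B" "\<And>i. i \<in> N \<Longrightarrow> v i \<bullet> y = 0"
  shows "y = 0"
proof -
  have "(\<Sum>e\<in>X. \<sigma> e * (y \<bullet> e)\<^sup>2) = (\<Sum>e\<in>B. \<sigma> e * (y \<bullet> e)\<^sup>2)"
    using assms by (intro sum_eigensum[symmetric, OF assms(1)]) auto
  also have "\<dots> = 0" using assms(4) by (simp flip: sum_coords_B)
  finally have "\<forall>e\<in>X. \<sigma> e * (y \<bullet> e)\<^sup>2 = 0"
    using assms(2,3) finite_subset[OF assms(3) finite_B]
    by (subst (asm) sum_nonneg_eq_0_iff) (auto intro!: mult_nonneg_nonneg less_imp_le[of 0 "\<sigma> _"])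
  then have "y \<bullet> e = 0" if "e \<in> B" for e
    using assms(1,2) that by (cases "e \<in> X") (force dest: eigensumD)+
  then show ?thesis using B_expand[of y] by simp
qed

definition upper :: "real \<Rightarrow> 'a set" where "upper s = {e \<in> B. s \<le> \<sigma> e}"

lemma upper_subset [simp]: "upper s \<subseteq> B" by (auto simp: upper_def)

lemma finite_upper [simp]: "finite (upper s)"
  using finite_subset[OF upper_subset] by simp

text \<open>
  At \<open>s = 1\<close>, for \<open>z\<close> in the span of the eigenvectors in question, this is the amount by which
  \<open>\<parallel>S z\<parallel>\<^sup>2 - z \<bullet> S z\<close> exceeds the sum of the positive \<open>\<sigma> e - 1\<close>. Larger thresholds \<open>s\<close> ignore the lower part of the spectrum and make it possible to reach \<open>s = 1\<close> in
  steps.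
\<close>
definition surplus :: "real \<Rightarrow> 'a \<Rightarrow> real" where
  "surplus s z = (\<Sum>e\<in>upper s. (\<sigma> e - s) * (\<sigma> e * (z \<bullet> e)\<^sup>2 - 1))"

text \<open>
  One step of summation by parts: lowering the threshold to the next eigenvalue adds a multiple of
  the difference between the sum of the squared coordinates and the dimension of the eigensum.
  At a vertex this difference is nonnegative.
\<close>
lemma surplus_lower_level:
  assumes "s' \<le> s" and gap: "\<And>e. e \<in> B \<Longrightarrow> \<not> (s' < \<sigma> e \<and> \<sigma> e < s)" and z: "z \<in> eigensum (upper s)"
  shows "surplus s' z = surplus s z + (s - s') * ((\<Sum>i\<in>N. (v i \<bullet> z)\<^sup>2) - real (card (upper s)))"
proof -
  have "surplus s' z = (\<Sum>e\<in>upper s. (\<sigma> e - s') * (\<sigma> e * (z \<bullet> e)\<^sup>2 - 1))"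
    unfolding surplus_def
  proof (rule sum.mono_neutral_right)
    show "\<forall>e\<in>upper s' - upper s. (\<sigma> e - s') * (\<sigma> e * (z \<bullet> e)\<^sup>2 - 1) = 0"
      using gap by (force simp: upper_def)
  qed (use assms(1) in \<open>auto simp: upper_def\<close>)
  also have "\<dots> = (\<Sum>e\<in>upper s. (\<sigma> e - s) * (\<sigma> e * (z \<bullet> e)\<^sup>2 - 1) + (s - s') * (\<sigma> e * (z \<bullet> e)\<^sup>2 - 1))"
    by (intro sum.cong) (auto simp: algebra_simps)
  also have "\<dots> = surplus s z + (s - s') * ((\<Sum>e\<in>upper s. \<sigma> e * (z \<bullet> e)\<^sup>2) - real (card (upper s)))"
    by (simp add: surplus_def sum.distrib sum_distrib_left sum_subtractf algebra_simps)
  also have "(\<Sum>e\<in>upper s. \<sigma> e * (z \<bullet> e)\<^sup>2) = (\<Sum>i\<in>N. (v i \<bullet> z)\<^sup>2)"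
    unfolding sum_coords_B by (intro sum_eigensum[OF z, symmetric]) auto
  finally show ?thesis .
qed

lemma excess_eq_surplus_one:
  assumes z: "z \<in> eigensum (upper 1)"
  shows "(norm (frame_op z))\<^sup>2 - z \<bullet> frame_op z =
    surplus 1 z + (real (card N) - real (DIM('a))) + (\<Sum>e\<in>B - upper 1. 1 - \<sigma> e)"
proof -
  have "(norm (frame_op z))\<^sup>2 - z \<bullet> frame_op z = (\<Sum>e\<in>B. (\<sigma> e - 1) * (\<sigma> e * (z \<bullet> e)\<^sup>2))"
    unfolding norm_frame_op_B inner_frame_op_self sum_coords_B
    by (simp add: sum_subtractf[symmetric] power2_eq_square algebra_simps)
  also have "\<dots> = (\<Sum>e\<in>upper 1. (\<sigma> e - 1) * (\<sigma> e * (z \<bullet> e)\<^sup>2))"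
    by (intro sum_eigensum[OF z]) auto
  also have "\<dots> = surplus 1 z + (\<Sum>e\<in>upper 1. \<sigma> e - 1)"
    by (simp add: surplus_def sum.distrib[symmetric] algebra_simps)
  also have "(\<Sum>e\<in>upper 1. \<sigma> e - 1) = (\<Sum>e\<in>B. \<sigma> e - 1) - (\<Sum>e\<in>B - upper 1. \<sigma> e - 1)"
    using sum.subset_diff[OF upper_subset finite_B, of "\<lambda>e. \<sigma> e - 1" 1] by simp
  also have "(\<Sum>e\<in>B. \<sigma> e - 1) = real (card N) - real (DIM('a))"
    by (simp add: sum_subtractf sum_eigenvalues card_B)
  also have "(\<Sum>e\<in>B - upper 1. \<sigma> e - 1) = - (\<Sum>e\<in>B - upper 1. 1 - \<sigma> e)"
    by (simp add: sum_negf[symmetric])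
  finally show ?thesis by simp
qed

lemma previous_level:
  assumes "1 < s"
  obtains s' where "1 \<le> s'" "s' < s" "\<And>e. e \<in> B \<Longrightarrow> \<not> (s' < \<sigma> e \<and> \<sigma> e < s)" "s' = 1 \<or> s' \<in> \<sigma> ` B"
proof -
  \<comment> \<open>the value \<open>1\<close> stops the descent even if it is not an eigenvalue\<close>
  define C where "C = insert 1 {x \<in> \<sigma> ` B. 1 \<le> x \<and> x < s}"
  have fin: "finite C" and ne: "C \<noteq> {}" by (simp_all add: C_def)
  have "Max C \<in> C" using fin ne by (rule Max_in)
  moreover have "\<not> (Max C < \<sigma> e \<and> \<sigma> e < s)" if e: "e \<in> B" for e
  proof
    assume a: "Max C < \<sigma> e \<and> \<sigma> e < s"
    moreover have "1 \<le> Max C" using fin by (simp add: C_def)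
    ultimately have "\<sigma> e \<in> C" using e by (auto simp: C_def)
    then show False using Max_ge[OF fin, of "\<sigma> e"] a by simp
  qed
  ultimately show thesis using assms by (intro that[of "Max C"]) (auto simp: C_def)
qed

text \<open>
  Alternately move to a vertex of the current section, by convexity without loss of surplus, and
  lower the threshold to the next eigenvalue, which at a vertex does not lose surplus either. When
  the threshold reaches \<open>1\<close>, the bound on signed sums applies.
\<close>
lemma surplus_le:
  "1 \<le> s \<Longrightarrow> z \<in> eigensum (upper s) \<Longrightarrow> z \<in> slab_body \<Longrightarrow>
    surplus s z \<le> - (\<Sum>e\<in>B - upper 1. 1 - \<sigma> e)"
proof (induction "card {e \<in> B. 1 < \<sigma> e \<and> \<sigma> e < s}" arbitrary: s z rule: less_induct)
  case less
  show ?case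
  proof (cases "s = 1")
    case True
    then show ?thesis
      using excess_eq_surplus_one[of z] excess_le[of z] less.prems by simp
  next
    case False
    then have s: "1 < s" using less.prems by simp
    obtain s' where s': "1 \<le> s'" "s' < s" and gap: "\<And>e. e \<in> B \<Longrightarrow> \<not> (s' < \<sigma> e \<and> \<sigma> e < s)"
      and lev: "s' = 1 \<or> s' \<in> \<sigma> ` B"
      using previous_level[OF s] by metis
    have "\<exists>z'. section_vertex (eigensum (upper s)) z' \<and>
      (\<Sum>e\<in>upper s. ((\<sigma> e - s) * \<sigma> e) * (z \<bullet> e)\<^sup>2) \<le> (\<Sum>e\<in>upper s. ((\<sigma> e - s) * \<sigma> e) * (z' \<bullet> e)\<^sup>2)"
    proof (rule section_vertex_exists)
      show "y = 0" if "y \<in> eigensum (upper s)" "\<And>i. i \<in> N \<Longrightarrow> v i \<bullet> y = 0" for y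
        using eigensum_coords_inj[OF that(1) _ upper_subset that(2)] s by (force simp: upper_def)
      show "0 \<le> (\<sigma> e - s) * \<sigma> e" if "e \<in> upper s" for e
        using that s by (simp add: upper_def)
    qed (use less.prems in auto)
    then obtain z' where vert: "section_vertex (eigensum (upper s)) z'"
      and "(\<Sum>e\<in>upper s. ((\<sigma> e - s) * \<sigma> e) * (z \<bullet> e)\<^sup>2) \<le> (\<Sum>e\<in>upper s. ((\<sigma> e - s) * \<sigma> e) * (z' \<bullet> e)\<^sup>2)"
      by blast
    then have step1: "surplus s z \<le> surplus s z'"
      by (simp add: surplus_def right_diff_distrib sum_subtractf mult.assoc)
    have z': "z' \<in> eigensum (upper s)" "z' \<in> slab_body"
      using vert by (auto simp: section_vertex_def)
    have "card (upper s) \<le> card (active z')"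
      using section_vertex_dim_le[OF subspace_eigensum vert] by (simp add: dim_eigensum)
    then have "real (card (upper s)) \<le> (\<Sum>i\<in>N. (v i \<bullet> z')\<^sup>2)"
      using card_active_le[OF z'(2)] by linarith
    then have "surplus s z' \<le> surplus s' z'"
      using surplus_lower_level[OF _ gap z'(1)] s' by simp
    moreover have "surplus s' z' \<le> - (\<Sum>e\<in>B - upper 1. 1 - \<sigma> e)"
    proof (cases "s' = 1")
      case True
      have "z' \<in> eigensum (upper 1)"
        using z'(1) s by (auto simp: upper_def eigensum_def)
      then show ?thesis
        using excess_eq_surplus_one[of z'] excess_le[of z'] z' True by simp
    next
      case False
      then obtain e where e: "e \<in> B" "\<sigma> e = s'" "s' > 1" using lev s' by auto
      have "{e \<in> B. 1 < \<sigma> e \<and> \<sigma> e < s'} \<subset> {e \<in> B. 1 < \<sigma> e \<and> \<sigma> e < s}"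
        using e s' by auto
      then have "card {e \<in> B. 1 < \<sigma> e \<and> \<sigma> e < s'} < card {e \<in> B. 1 < \<sigma> e \<and> \<sigma> e < s}"
        by (intro psubset_card_mono) auto
      moreover have "z' \<in> eigensum (upper s')"
        using z'(1) s' by (auto simp: upper_def eigensum_def)
      ultimately show ?thesis using less.hyps s' z' by blast
    qed
    ultimately show ?thesis using step1 by linarith
  qed
qed

text \<open>
  With a threshold above all eigenvalues the point \<open>0\<close> has surplus \<open>0\<close>, which leaves no room for
  eigenvalues below \<open>1\<close>.
\<close>
lemma eigenvalue_ge_1: "e \<in> B \<Longrightarrow> 1 \<le> \<sigma> e"
proof -
  assume e: "e \<in> B"
  define s where "s = Max (insert 1 (\<sigma> ` B)) + 1"
  have "\<sigma> e' < s" if "e' \<in> B" for e'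
    proof -
    have "\<sigma> e' \<le> Max (insert 1 (\<sigma> ` B))" using that by (intro Max_ge) auto
    then show ?thesis by (simp add: s_def)
  qed
  then have empty: "upper s = {}" by (force simp: upper_def)
  have "1 \<le> Max (insert 1 (\<sigma> ` B))" by (intro Max_ge) auto
  then have "1 \<le> s" unfolding s_def by linarith
  then have "surplus s 0 \<le> - (\<Sum>e\<in>B - upper 1. 1 - \<sigma> e)"
    by (rule surplus_le) (auto simp: eigensum_def slab_body_def)
  then have le: "(\<Sum>e\<in>B - upper 1. 1 - \<sigma> e) \<le> 0" by (simp add: surplus_def empty)
  show "1 \<le> \<sigma> e"
  proof (rule ccontr)
    assume "\<not> 1 \<le> \<sigma> e"
    then have "(\<Sum>e\<in>B - upper 1. 1 - \<sigma> e) > 0"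
      using e by (intro sum_pos2[of _ e]) (auto simp: upper_def)
    with le show False by simp
  qed
qed

lemma upper_1: "upper 1 = B"
  using eigenvalue_ge_1 by (auto simp: upper_def)

lemma surplus_nonpos:
  "1 \<le> s \<Longrightarrow> z \<in> eigensum (upper s) \<Longrightarrow> z \<in> slab_body \<Longrightarrow> surplus s z \<le> 0"
  using surplus_le[of s z] by (simp add: upper_1)

end


section \<open>Rigidity: vertices have coordinates in \<open>{-1, 0, 1}\<close>\<close>

context bounded_signed_sums begin

text \<open>
  If \<open>z\<close> attains the maximal value, then moving its zero coordinates inside the cube cannot gain
  anything. As the objective is affine in each coordinate, this forces all first-order and mixed
  second-order terms to vanish, as the next two lemmas spell out.
\<close>
lemma inactive_perturbation_le:
  assumes z: "z \<in> slab_body"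
    and tight: "(norm (frame_op z))\<^sup>2 - z \<bullet> frame_op z = real (card N) - real (DIM('a))"
    and a: "\<And>i. i \<in> N \<Longrightarrow> \<bar>a i\<bar> \<le> 1" "\<And>i. i \<in> N \<Longrightarrow> v i \<bullet> z \<noteq> 0 \<Longrightarrow> a i = 0"
  shows "2 * (frame_op z \<bullet> (\<Sum>i\<in>N. a i *\<^sub>R v i)) + (norm (\<Sum>i\<in>N. a i *\<^sub>R v i))\<^sup>2 \<le> (\<Sum>i\<in>N. (a i)\<^sup>2)"
proof -
  define w where "w = (\<Sum>i\<in>N. a i *\<^sub>R v i)"
  have "\<bar>v i \<bullet> z + a i\<bar> \<le> 1" if "i \<in> N" for i
    using z a[OF that] that by (cases "v i \<bullet> z = 0") (auto simp: slab_body_def)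
  from cube_point_le[OF this]
  have "(norm (frame_op z + w))\<^sup>2 + (\<Sum>i\<in>N. 1 - (v i \<bullet> z + a i)\<^sup>2) \<le> 2 * real (card N) - real (DIM('a))"
    by (simp add: frame_op_def w_def scaleR_add_left sum.distrib)
  moreover have "(\<Sum>i\<in>N. 1 - (v i \<bullet> z + a i)\<^sup>2) = (\<Sum>i\<in>N. 1 - (v i \<bullet> z)\<^sup>2 - (a i)\<^sup>2)"
  proof (intro sum.cong refl)
    fix i assume "i \<in> N"
    then show "1 - (v i \<bullet> z + a i)\<^sup>2 = 1 - (v i \<bullet> z)\<^sup>2 - (a i)\<^sup>2"
      using a(2)[of i] by (cases "v i \<bullet> z = 0") auto
  qed
  moreover have "(norm (frame_op z + w))\<^sup>2 = (norm (frame_op z))\<^sup>2 + 2 * (frame_op z \<bullet> w) + (norm w)\<^sup>2"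
    unfolding power2_norm_eq_inner by (simp add: inner_simps inner_commute)
  ultimately show ?thesis
    using tight by (simp add: w_def[symmetric] sum_subtractf inner_frame_op_self)
qed

lemma inactive_orthogonal_sum:
  assumes z: "z \<in> slab_body"
    and tight: "(norm (frame_op z))\<^sup>2 - z \<bullet> frame_op z = real (card N) - real (DIM('a))"
    and r: "r \<in> N" "v r \<bullet> z = 0"
  shows "frame_op z \<bullet> v r = 0"
proof -
  have "2 * (frame_op z \<bullet> (c *\<^sub>R v r)) + (norm (c *\<^sub>R v r))\<^sup>2 \<le> c\<^sup>2" if "\<bar>c\<bar> \<le> 1" for c
  proof -
    have sv: "(\<Sum>i\<in>N. (if i = r then c else 0) *\<^sub>R v i) = c *\<^sub>R v r"
      using finite_N r by (simp add: if_distrib[of "\<lambda>x. x *\<^sub>R _"] cong: if_cong)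
    have s2: "(\<Sum>i\<in>N. (if i = r then c else 0)\<^sup>2) = c\<^sup>2"
      using finite_N r by (simp add: if_distrib[of "\<lambda>x. x\<^sup>2"] cong: if_cong)
    show ?thesis
      by (rule inactive_perturbation_le[OF z tight, of "\<lambda>i. if i = r then c else 0", unfolded sv s2])
        (use r that in auto)
  qed
  from this[of 1] this[of "-1"] show ?thesis using unit r by simp
qed

lemma inactive_pairwise_orthogonal:
  assumes z: "z \<in> slab_body"
    and tight: "(norm (frame_op z))\<^sup>2 - z \<bullet> frame_op z = real (card N) - real (DIM('a))"
    and r: "r \<in> N" "v r \<bullet> z = 0" and l: "l \<in> N" "v l \<bullet> z = 0" and "r \<noteq> l"
  shows "v r \<bullet> v l = 0"
proof -
  have "(norm (v r + c *\<^sub>R v l))\<^sup>2 \<le> 1 + c\<^sup>2" if "\<bar>c\<bar> \<le> 1" for c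
  proof -
    define a where "a i = (if i = r then 1 else 0) + (if i = l then c else 0)" for i
    have sv: "(\<Sum>i\<in>N. a i *\<^sub>R v i) = v r + c *\<^sub>R v l"
      using finite_N r l
      by (simp add: a_def scaleR_add_left sum.distrib if_distrib[of "\<lambda>x. x *\<^sub>R _"] cong: if_cong)
    have "(a i)\<^sup>2 = (if i = r then 1 else 0) + (if i = l then c\<^sup>2 else 0)" for i
      using \<open>r \<noteq> l\<close> by (auto simp: a_def)
    then have s2: "(\<Sum>i\<in>N. (a i)\<^sup>2) = 1 + c\<^sup>2"
      using finite_N r l by (simp add: sum.distrib)
    have "2 * (frame_op z \<bullet> (v r + c *\<^sub>R v l)) + (norm (v r + c *\<^sub>R v l))\<^sup>2 \<le> 1 + c\<^sup>2"
      by (rule inactive_perturbation_le[OF z tight, of a, unfolded sv s2])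
        (use r l that \<open>r \<noteq> l\<close> in \<open>auto simp: a_def\<close>)
    moreover have "frame_op z \<bullet> (v r + c *\<^sub>R v l) = 0"
      using inactive_orthogonal_sum[OF z tight] r l by (simp add: inner_simps)
    ultimately show ?thesis by simp
  qed
  moreover have "(norm (v r + c *\<^sub>R v l))\<^sup>2 = 1 + 2 * c * (v r \<bullet> v l) + c\<^sup>2" for c
  proof -
    have "v r \<bullet> v r = 1" "v l \<bullet> v l = 1" using unit r l by (simp_all add: norm_eq_1)
    then show ?thesis
      unfolding power2_norm_eq_inner by (simp add: inner_simps inner_commute power2_eq_square)
  qed
  ultimately have "2 * c * (v r \<bullet> v l) \<le> 0" if "\<bar>c\<bar> \<le> 1" for c
    using that by simp
  from this[of 1] this[of "-1"] show ?thesis by simp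
qed

end

context bounded_signed_sums_eigen begin

definition above :: "real \<Rightarrow> 'a set" where "above s = {e \<in> B. s < \<sigma> e}"

lemma above_subset [simp]: "above s \<subseteq> B" by (auto simp: above_def)

lemma finite_above [simp]: "finite (above s)"
  using finite_subset[OF above_subset] by simp

lemma above_coords_inj:
  assumes "0 \<le> s" "y \<in> eigensum (above s)" "\<And>i. i \<in> N \<Longrightarrow> v i \<bullet> y = 0"
  shows "y = 0"
  using eigensum_coords_inj[OF assms(2) _ above_subset assms(3)] assms(1) by (force simp: above_def)

lemma surplus_above: "surplus s z = (\<Sum>e\<in>above s. (\<sigma> e - s) * (\<sigma> e * (z \<bullet> e)\<^sup>2 - 1))"
  unfolding surplus_def
  by (rule sum.mono_neutral_right) (auto simp: upper_def above_def)

text \<open>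
  Moving both ways along \<open>y\<close> changes the surplus on average by a positive combination of
  the squares \<open>(y \<bullet> e)\<^sup>2\<close> with \<open>e\<close> above the threshold. No surplus is available, so these vanish.
\<close>
lemma no_surplus_off_vertex:
  assumes s: "1 \<le> s" and z: "z \<in> eigensum (above s)" "z \<in> slab_body" "surplus s z = 0"
    and y: "y \<in> eigensum (upper s)" "\<And>i. i \<in> active z \<Longrightarrow> v i \<bullet> y = 0"
  shows "y \<in> eigensum (upper s - above s)"
proof -
  obtain \<delta> where \<delta>: "\<delta> > 0" "z + \<delta> *\<^sub>R y \<in> slab_body" "z - \<delta> *\<^sub>R y \<in> slab_body"
    using slab_body_two_sided_step[OF z(2) y(2)] by blast
  have zu: "z \<in> eigensum (upper s)"
    using z(1) by (auto simp: eigensum_def above_def upper_def)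
  have "z + \<delta> *\<^sub>R y \<in> eigensum (upper s)" "z - \<delta> *\<^sub>R y \<in> eigensum (upper s)"
    using zu y(1) by (simp_all add: subspace_add subspace_diff subspace_scale)
  then have "surplus s (z + \<delta> *\<^sub>R y) + surplus s (z - \<delta> *\<^sub>R y) \<le> 0"
    using surplus_nonpos[OF s] \<delta> by (simp add: add_nonpos_nonpos)
  moreover have "surplus s (z + \<delta> *\<^sub>R y) + surplus s (z - \<delta> *\<^sub>R y)
    = 2 * surplus s z + 2 * \<delta>\<^sup>2 * (\<Sum>e\<in>above s. (\<sigma> e - s) * \<sigma> e * (y \<bullet> e)\<^sup>2)"
    unfolding surplus_above
    by (simp add: sum_distrib_left sum.distrib[symmetric] inner_simps power2_eq_square algebra_simps)
  ultimately have "\<delta>\<^sup>2 * (\<Sum>e\<in>above s. (\<sigma> e - s) * \<sigma> e * (y \<bullet> e)\<^sup>2) \<le> 0"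
    using z(3) by simp
  then have "(\<Sum>e\<in>above s. (\<sigma> e - s) * \<sigma> e * (y \<bullet> e)\<^sup>2) \<le> 0"
    using \<delta>(1) by (simp add: mult_le_0_iff)
  moreover have nonneg: "0 \<le> (\<sigma> e - s) * \<sigma> e * (y \<bullet> e)\<^sup>2" if "e \<in> above s" for e
    using that s by (intro mult_nonneg_nonneg) (auto simp: above_def)
  ultimately have "(\<Sum>e\<in>above s. (\<sigma> e - s) * \<sigma> e * (y \<bullet> e)\<^sup>2) = 0"
    by (intro antisym sum_nonneg)
  then have "\<forall>e\<in>above s. (\<sigma> e - s) * \<sigma> e * (y \<bullet> e)\<^sup>2 = 0"
    using nonneg by (subst (asm) sum_nonneg_eq_0_iff) auto
  then have "y \<bullet> e = 0" if "e \<in> above s" for e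
    using that s by (force simp: above_def)
  then show ?thesis using y(1) by (auto simp: eigensum_def)
qed

text \<open>
  Induction over the eigenvalues above \<open>s\<close>, where \<open>t\<close> denotes the smallest of them. Let \<open>a\<close> be a vertex for the
  eigenvalues above \<open>t\<close>. By the previous lemma, vectors that vanish on the active set of \<open>a\<close> lie in the
  eigenspace \<open>E\<close> of \<open>t\<close>, and since exactly as many coordinates are active as there are eigenvalues above \<open>t\<close>,
  a dimension count shows that conversely all of \<open>E\<close> vanishes on the active set. Every coordinate that is used
  above \<open>t\<close> is active for some vertex, so the two spaces have disjoint supports. A vertex for the eigenvalues
  above \<open>s\<close> therefore splits into a vertex above \<open>t\<close> and a part in \<open>E\<close>. It has surplus \<open>0\<close> at the threshold \<open>t\<close>, and
  any coordinate beyond the minimal number would produce positive surplus at \<open>s\<close>.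
\<close>
lemma tight_vertices:
  "1 \<le> s \<Longrightarrow> section_vertex (eigensum (above s)) z \<Longrightarrow>
    surplus s z = 0 \<and> card (active z) = card (above s) \<and> (\<forall>i\<in>N - active z. v i \<bullet> z = 0)"
proof (induction "card (above s)" arbitrary: s z rule: less_induct)
  case less
  note s = less.prems(1)
  have z: "z \<in> eigensum (above s)" "z \<in> slab_body"
    using less.prems(2) by (auto simp: section_vertex_def)
  show ?case
  proof (cases "above s = {}")
    case True
    then have "z = 0" using z(1) B_expand[of z] by (simp add: eigensum_def)
    then show ?thesis using True by (simp add: surplus_above active_def)
  next
    case False
    define t where "t = Min (\<sigma> ` above s)"
    have "t \<in> \<sigma> ` above s" unfolding t_def using False by (intro Min_in) auto
    then have st: "s < t" by (auto simp: above_def)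
    have t1: "1 \<le> t" using s st by simp
    have tle: "t \<le> \<sigma> e" if "e \<in> above s" for e
      unfolding t_def using that by (intro Min_le) auto
    have up: "upper t = above s" using tle st by (force simp: upper_def above_def)
    have sub: "above t \<subset> above s" using st \<open>t \<in> \<sigma> ` above s\<close> by (auto simp: above_def)
    then have "card (above t) < card (above s)" by (intro psubset_card_mono) auto
    note IH = less.hyps[OF this t1]
    define E where "E = eigensum (above s - above t)"
    have drop: "y \<in> E" if a: "section_vertex (eigensum (above t)) a" and "y \<in> eigensum (above s)"
      "\<And>i. i \<in> active a \<Longrightarrow> v i \<bullet> y = 0" for a y
      using no_surplus_off_vertex[OF t1, of a y] IH[OF a] a that up
      by (auto simp: E_def section_vertex_def)
    have vanish: "v i \<bullet> y = 0"
      if a: "section_vertex (eigensum (above t)) a" and i: "i \<in> active a" and y: "y \<in> E" for a i y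
    proof -
      define D where "D = {y \<in> eigensum (above s). \<forall>i\<in>active a. v i \<bullet> y = 0}"
      have D: "subspace D"
        using subspace_eigensum[of "above s"] by (auto simp: D_def subspace_def inner_simps)
      have DE: "D \<subseteq> E" using drop[OF a] by (auto simp: D_def)
      have "dim E = card (above s) - card (above t)"
        using sub by (simp add: E_def dim_eigensum card_Diff_subset psubset_imp_subset
            order_trans[OF Diff_subset])
      moreover have "card (above s) \<le> dim D + card (active a)"
        using dim_le_dim_kernel_plus_card[OF subspace_eigensum finite_active, of "above s" a]
        by (simp add: D_def dim_eigensum)
      moreover have "card (active a) = card (above t)" using IH[OF a] by simp
      ultimately have "dim E \<le> dim D" by linarith
      then have "D = E"
        using D DE by (intro subspace_dim_equal) (auto simp: E_def)
      then show ?thesis using y i by (auto simp: D_def)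
    qed
    have disjoint: "v i \<bullet> y = 0"
      if i: "i \<in> N" and y0: "y0 \<in> eigensum (above t)" "v i \<bullet> y0 \<noteq> 0" and y: "y \<in> E" for i y0 y
    proof -
      obtain \<delta> where \<delta>: "\<delta> > 0" "0 + \<delta> *\<^sub>R y0 \<in> slab_body"
        using slab_body_two_sided_step[of 0 y0] by (auto simp: slab_body_def active_def)
      \<comment> \<open>maximise the square of the \<open>i\<close>-th coordinate, to get a vertex where it is nonzero\<close>
    have "\<exists>a. section_vertex (eigensum (above t)) a \<and>
          (\<Sum>e\<in>{v i}. 1 * ((\<delta> *\<^sub>R y0) \<bullet> e)\<^sup>2) \<le> (\<Sum>e\<in>{v i}. 1 * (a \<bullet> e)\<^sup>2)"
      proof (rule section_vertex_exists)
        show "y = 0" if "y \<in> eigensum (above t)" "\<And>i. i \<in> N \<Longrightarrow> v i \<bullet> y = 0" for y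
          using above_coords_inj[OF _ that] t1 by simp
      qed (use \<delta> y0 in \<open>auto simp: subspace_scale\<close>)
      then obtain a where a: "section_vertex (eigensum (above t)) a"
        and le: "((\<delta> *\<^sub>R y0) \<bullet> v i)\<^sup>2 \<le> (a \<bullet> v i)\<^sup>2" by auto
      have "(\<delta> *\<^sub>R y0) \<bullet> v i \<noteq> 0" using \<delta> y0 by (simp add: inner_commute)
      then have "0 < ((\<delta> *\<^sub>R y0) \<bullet> v i)\<^sup>2" by simp
      then have "v i \<bullet> a \<noteq> 0" using le by (auto simp: inner_commute)
      then have "i \<in> active a" using IH[OF a] i by blast
      then show ?thesis using vanish[OF a _ y] by blast
    qed
    \<comment> \<open>the part of \<open>z\<close> above \<open>t\<close>; the rest of \<open>z\<close> lies in \<open>E\<close>\<close>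
    define a where "a = (\<Sum>e\<in>above t. (z \<bullet> e) *\<^sub>R e)"
    have ae: "a \<bullet> e = (if e \<in> above t then z \<bullet> e else 0)" if "e \<in> B" for e
    proof -
      have "a \<bullet> e = (\<Sum>e'\<in>above t. if e' = e then z \<bullet> e' else 0)"
        unfolding a_def inner_sum_left using that
        by (intro sum.cong) (auto simp: B_inner above_def)
      then show ?thesis by simp
    qed
    have aL: "a \<in> eigensum (above t)" using ae by (auto simp: eigensum_def)
    have bE: "z - a \<in> E"
      using z(1) ae sub by (auto simp: E_def eigensum_def inner_simps)
    have coord: "v i \<bullet> a = 0 \<or> v i \<bullet> (z - a) = 0" if "i \<in> N" for i
      using disjoint[OF that aL _ bE] by blast
    have aK: "a \<in> slab_body"
      unfolding slab_body_def
    proof safe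
      fix i assume "i \<in> N"
      then show "\<bar>v i \<bullet> a\<bar> \<le> 1"
        using coord[of i] z(2) by (auto simp: slab_body_def inner_simps)
    qed
    have "section_vertex (eigensum (above t)) a"
      unfolding section_vertex_def
    proof (intro conjI ballI impI aL aK)
      fix y assume y: "y \<in> eigensum (above t)" "\<forall>i\<in>active a. v i \<bullet> y = 0"
      have "v i \<bullet> y = 0" if "i \<in> active z" for i
      proof (rule ccontr)
        assume "v i \<bullet> y \<noteq> 0"
        then have "v i \<bullet> (z - a) = 0" using disjoint[OF _ y(1) _ bE] that by (auto simp: active_def)
        then have "i \<in> active a" using that by (simp add: active_def inner_simps)
        with y(2) \<open>v i \<bullet> y \<noteq> 0\<close> show False by blast
      qed
      moreover have "y \<in> eigensum (above s)" using y(1) sub eigensum_mono by blast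
      ultimately show "y = 0" using less.prems(2) by (auto simp: section_vertex_def)
    qed
    then have "surplus t a = 0" using IH by blast
    then have "surplus t z = 0" by (simp add: surplus_above ae above_def)
    then have eq: "surplus s z = (t - s) * ((\<Sum>i\<in>N. (v i \<bullet> z)\<^sup>2) - real (card (above s)))"
      using surplus_lower_level[of s t z] z(1) st tle up by (force simp: above_def)
    have "z \<in> eigensum (upper s)" using z(1) by (auto simp: eigensum_def above_def upper_def)
    then have "surplus s z \<le> 0" using surplus_nonpos[OF s] z(2) by blast
    then have "(\<Sum>i\<in>N. (v i \<bullet> z)\<^sup>2) \<le> real (card (above s))"
      using eq st by (simp add: mult_le_0_iff)
    moreover have "card (above s) \<le> card (active z)"
      using section_vertex_dim_le[OF subspace_eigensum less.prems(2)] by (simp add: dim_eigensum)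
    moreover have "real (card (active z)) \<le> (\<Sum>i\<in>N. (v i \<bullet> z)\<^sup>2)"
      using card_active_le[OF z(2)] .
    ultimately have "(\<Sum>i\<in>N. (v i \<bullet> z)\<^sup>2) = real (card (above s))"
      "card (active z) = card (above s)" by linarith+
    then show ?thesis using eq inactive_coords_zero[of z] by auto
  qed
qed

lemma frame_op_ge: "w \<bullet> w \<le> w \<bullet> frame_op w"
proof -
  have "(\<Sum>e\<in>B. 1 * (w \<bullet> e)\<^sup>2) \<le> (\<Sum>e\<in>B. \<sigma> e * (w \<bullet> e)\<^sup>2)"
    by (intro sum_mono mult_right_mono) (auto simp: eigenvalue_ge_1)
  moreover have "w \<bullet> w = (\<Sum>e\<in>B. 1 * (w \<bullet> e)\<^sup>2)"
    by (subst inner_B_expand) (simp add: power2_eq_square)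
  ultimately show ?thesis
    by (simp only: inner_frame_op_self sum_coords_B)
qed

lemma frame_op_surj: "\<exists>w. frame_op w = u"
proof -
  have "w = 0" if "frame_op w = 0" for w
    using frame_op_ge[of w] that by (metis inner_eq_zero_iff inner_ge_zero inner_zero_right antisym)
  then have "inj frame_op"
    using linear_frame_op by (simp add: linear_injective_0)
  then have "surj frame_op" using linear_frame_op by (simp add: linear_injective_imp_surjective)
  then show ?thesis by (metis surjD)
qed

abbreviation tight_space :: "'a set" where "tight_space \<equiv> eigensum (above 1)"

lemma tight_space_vertex:
  assumes "section_vertex tight_space z"
  shows "z \<in> slab_body" "card (active z) = dim tight_space" "\<And>i. i \<in> N - active z \<Longrightarrow> v i \<bullet> z = 0"
    "(norm (frame_op z))\<^sup>2 - z \<bullet> frame_op z = real (card N) - real (DIM('a))"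
proof -
  note t = tight_vertices[OF order_refl assms]
  have z: "z \<in> eigensum (upper 1)" "z \<in> slab_body"
    using assms by (auto simp: section_vertex_def eigensum_def above_def upper_def)
  show "z \<in> slab_body" "card (active z) = dim tight_space" "\<And>i. i \<in> N - active z \<Longrightarrow> v i \<bullet> z = 0"
    using t z by (auto simp: dim_eigensum)
  show "(norm (frame_op z))\<^sup>2 - z \<bullet> frame_op z = real (card N) - real (DIM('a))"
    using excess_eq_surplus_one[OF z(1)] t by (simp add: upper_1)
qed

text \<open>
  Eigenvalues above \<open>1\<close> give a strict inequality. It rules out that a unit coordinate vector comes from
  the tight space, and it makes the inner products inside a block negative.
\<close>
lemma tight_space_expands:
  assumes "y \<in> tight_space" "y \<noteq> 0"
  shows "(\<Sum>i\<in>N. (v i \<bullet> y)\<^sup>2) < (norm (frame_op y))\<^sup>2"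
proof -
  have "\<exists>e\<in>above 1. y \<bullet> e \<noteq> 0"
  proof (rule ccontr)
    assume "\<not> ?thesis"
    then have "\<forall>e\<in>B. y \<bullet> e = 0" using assms(1) by (auto simp: eigensum_def)
    then show False using B_expand[of y] assms(2) by simp
  qed
  then obtain e where e: "e \<in> above 1" "y \<bullet> e \<noteq> 0" by blast
  have "0 < (\<Sum>e\<in>above 1. (\<sigma> e * (\<sigma> e - 1)) * (y \<bullet> e)\<^sup>2)"
    using e by (intro sum_pos2[of _ e]) (auto simp: above_def)
  also have "\<dots> = (\<Sum>e\<in>B. (\<sigma> e * (\<sigma> e - 1)) * (y \<bullet> e)\<^sup>2)"
    by (intro sum_eigensum[OF assms(1), symmetric]) auto
  also have "\<dots> = (norm (frame_op y))\<^sup>2 - (\<Sum>i\<in>N. (v i \<bullet> y)\<^sup>2)"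
    unfolding norm_frame_op_B sum_coords_B
    by (simp add: sum_subtractf[symmetric] power2_eq_square algebra_simps)
  finally show ?thesis by simp
qed

end


section \<open>Sliding along edges\<close>

context bounded_signed_sums_eigen begin

lemma tight_space_coords_inj:
  "y \<in> tight_space \<Longrightarrow> (\<And>i. i \<in> N \<Longrightarrow> v i \<bullet> y = 0) \<Longrightarrow> y = 0"
  using above_coords_inj[of 1 y] by simp

lemma tight_space_has_vertex: "\<exists>z. section_vertex tight_space z"
proof -
  have "0 \<in> tight_space" "0 \<in> slab_body" by (simp_all add: eigensum_def slab_body_def)
  then show ?thesis
    using section_vertex_exists[of tight_space "{}" "\<lambda>_. 0" 0] tight_space_coords_inj by auto
qed

lemma vertex_inactive_orthogonal_sum:
  "section_vertex tight_space z \<Longrightarrow> p \<in> N - active z \<Longrightarrow> frame_op z \<bullet> v p = 0"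
  using inactive_orthogonal_sum[of z p] tight_space_vertex[of z] by auto

lemma vertex_inactive_orthogonal:
  "section_vertex tight_space z \<Longrightarrow> p \<in> N - active z \<Longrightarrow> q \<in> N - active z \<Longrightarrow> p \<noteq> q \<Longrightarrow> v p \<bullet> v q = 0"
  using inactive_pairwise_orthogonal[of z p q] tight_space_vertex[of z] by auto

text \<open>
  Exchange of a basis element: the coordinates active at \<open>z\<close> determine a vector of the tight
  space, and the coordinate \<open>i\<close> may be replaced by any \<open>j\<close> at which the dual vector of \<open>i\<close> does not vanish.
\<close>
lemma section_vertexI_exchange:
  assumes z: "section_vertex tight_space z" and z': "z' \<in> tight_space" "z' \<in> slab_body"
    and y: "y \<in> tight_space" "\<And>k. k \<in> active z - {i} \<Longrightarrow> v k \<bullet> y = 0" "v i \<bullet> y \<noteq> 0"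
    and act: "active z - {i} \<subseteq> active z'" "j \<in> active z'" "v j \<bullet> y \<noteq> 0"
  shows "section_vertex tight_space z'"
  unfolding section_vertex_def
proof (intro conjI ballI impI z')
  fix w assume w: "w \<in> tight_space" "\<forall>k\<in>active z'. v k \<bullet> w = 0"
  define c where "c = (v i \<bullet> w) / (v i \<bullet> y)"
  have "w - c *\<^sub>R y \<in> tight_space" using w y by (simp add: subspace_diff subspace_scale)
  moreover have "v k \<bullet> (w - c *\<^sub>R y) = 0" if "k \<in> active z" for k
    using that w(2) act(1) y(2,3) by (cases "k = i") (auto simp: inner_simps c_def)
  ultimately have eq: "w - c *\<^sub>R y = 0"
    using z unfolding section_vertex_def by blast
  then have "w = c *\<^sub>R y" by simp
  moreover have "v j \<bullet> w = 0" using w(2) act(2) by blast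
  ultimately show "w = 0" using act(3) by auto
qed

lemma vertex_dual_vector:
  assumes z: "section_vertex tight_space z" and i: "i \<in> active z"
  obtains y where "y \<in> tight_space" "v i \<bullet> y = 1" "\<And>k. k \<in> active z - {i} \<Longrightarrow> v k \<bullet> y = 0"
proof -
  define D where "D = {y \<in> tight_space. \<forall>k\<in>active z - {i}. v k \<bullet> y = 0}"
  have "dim tight_space \<le> dim D + card (active z - {i})"
    unfolding D_def by (rule dim_le_dim_kernel_plus_card) simp_all
  moreover have "card (active z - {i}) < dim tight_space"
    using tight_space_vertex(2)[OF z] i by (metis card_Diff1_less finite_active)
  ultimately have "dim D \<noteq> 0" by linarith
  then have "\<not> D \<subseteq> {0}" by (simp only: dim_eq_0 not_False_eq_True)
  then obtain w where w: "w \<in> D" "w \<noteq> 0" by blast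
  have nz: "v i \<bullet> w \<noteq> 0"
  proof
    assume "v i \<bullet> w = 0"
    then have "\<forall>k\<in>active z. v k \<bullet> w = 0" using w(1) by (auto simp: D_def)
    then show False using w z by (auto simp: D_def section_vertex_def)
  qed
  show thesis
    by (rule that[of "(1 / (v i \<bullet> w)) *\<^sub>R w"]) (use w nz in \<open>auto simp: D_def subspace_scale\<close>)
qed

text \<open>
  Follow the edge from \<open>z\<close> along \<open>y\<close> up to the next vertex. There the number of
  coordinates \<open>\<plusminus>1\<close> is the same and all others are \<open>0\<close>. If no new coordinate became \<open>\<plusminus>1\<close>, then
  \<open>y\<close> would vanish outside \<open>i\<close>, which the expansion property excludes. Otherwise
  the coordinate \<open>i\<close> has to become exactly \<open>0\<close>, and precisely one other coordinate takes its place.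
\<close>
lemma vertex_dual_vector_partner:
  assumes z: "section_vertex tight_space z" and i: "i \<in> active z"
    and y: "y \<in> tight_space" "v i \<bullet> y = 1" "\<And>k. k \<in> active z - {i} \<Longrightarrow> v k \<bullet> y = 0"
  obtains j where "j \<in> N - active z" "\<bar>v j \<bullet> y\<bar> = 1" "\<And>k. k \<in> N - {i, j} \<Longrightarrow> v k \<bullet> y = 0"
proof -
  note zK = tight_space_vertex(1)[OF z] and z0 = tight_space_vertex(3)[OF z]
  have iN: "i \<in> N" using i active_subset by blast
  have zi: "\<bar>v i \<bullet> z\<bar> = 1" using i by (simp add: active_def)
  have "\<exists>k\<in>N - active z. v k \<bullet> y \<noteq> 0"
  proof (rule ccontr)
    assume "\<not> ?thesis"
    then have coord: "v k \<bullet> y = (if k = i then 1 else 0)" if "k \<in> N" for k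
      using y that by (cases "k \<in> active z") auto
    have "frame_op y = v i"
      using finite_N iN by (simp add: frame_op_def coord if_distrib[of "\<lambda>x. x *\<^sub>R _"] cong: if_cong)
    moreover have "(\<Sum>k\<in>N. (v k \<bullet> y)\<^sup>2) = 1"
      using finite_N iN by (simp add: coord if_distrib[of "\<lambda>x. x\<^sup>2"] cong: if_cong)
    moreover have "y \<noteq> 0" using y(2) by (metis inner_zero_right zero_neq_one)
    ultimately show False
      using tight_space_expands[OF y(1)] unit[OF iN] by simp
  qed
  then obtain k0 where k0: "k0 \<in> N - active z" "v k0 \<bullet> y \<noteq> 0" by blast
  define M where "M = (\<lambda>k. \<bar>v k \<bullet> y\<bar>) ` (N - active z)"
  define \<mu> where "\<mu> = Max M"
  have fin: "finite M" and ne: "M \<noteq> {}" using finite_N k0 by (auto simp: M_def)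
  have le: "\<bar>v k \<bullet> y\<bar> \<le> \<mu>" if "k \<in> N - active z" for k
    unfolding \<mu>_def using that fin by (intro Max_ge) (auto simp: M_def)
  obtain j where j: "j \<in> N - active z" "\<bar>v j \<bullet> y\<bar> = \<mu>"
    using Max_in[OF fin ne] by (auto simp: M_def \<mu>_def)
  have mu: "\<mu> > 0" using le[OF k0(1)] k0(2) by linarith
  \<comment> \<open>the step to the next vertex: either the coordinate \<open>i\<close> is reflected (\<open>\<delta> = 2\<close>), or before that some other coordinate reaches \<open>\<plusminus>1\<close>\<close>
  define \<delta> where "\<delta> = min 2 (1 / \<mu>)"
  have \<delta>: "\<delta> > 0" "\<delta> \<le> 2" "\<delta> * \<mu> \<le> 1"
    using mu by (auto simp: \<delta>_def min_def field_simps)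
  define z' where "z' = z - (\<delta> * (v i \<bullet> z)) *\<^sub>R y"
  have ci: "v i \<bullet> z' = (1 - \<delta>) * (v i \<bullet> z)"
    using y(2) by (simp add: z'_def inner_simps algebra_simps)
  have ca: "v k \<bullet> z' = v k \<bullet> z" if "k \<in> active z - {i}" for k
    using y(3)[OF that] by (simp add: z'_def inner_simps)
  have cz: "v k \<bullet> z' = - (\<delta> * (v i \<bullet> z) * (v k \<bullet> y))" if "k \<in> N - active z" for k
    using z0[OF that] by (simp add: z'_def inner_simps)
  have abs_cz: "\<bar>v k \<bullet> z'\<bar> = \<delta> * \<bar>v k \<bullet> y\<bar>" if "k \<in> N - active z" for k
    using cz[OF that] \<delta> zi by (simp add: abs_mult)
  have zL: "z' \<in> tight_space"
    using z y(1) by (simp add: z'_def section_vertex_def subspace_diff subspace_scale)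
  have zB: "z' \<in> slab_body"
    unfolding slab_body_def
  proof safe
    fix k assume k: "k \<in> N"
    consider "k = i" | "k \<in> active z - {i}" | "k \<in> N - active z" using k by blast
    then show "\<bar>v k \<bullet> z'\<bar> \<le> 1"
    proof cases
      case 1
      then show ?thesis using ci \<delta> zi by (simp add: abs_mult)
    next
      case 2
      then show ?thesis using ca zK k by (simp add: slab_body_def)
    next
      case 3
      have "\<delta> * \<bar>v k \<bullet> y\<bar> \<le> \<delta> * \<mu>" using le[OF 3] \<delta> by (intro mult_left_mono) auto
      then show ?thesis using abs_cz[OF 3] \<delta> by linarith
    qed
  qed
  have keep: "active z - {i} \<subseteq> active z'" using ca by (auto simp: active_def)
  have half: "\<mu> \<ge> 1 / 2"
  proof (rule ccontr)
    assume "\<not> ?thesis"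
    then have "\<delta> = 2" using mu by (simp add: \<delta>_def min_def field_simps)
    then have "i \<in> active z'" using ci zi iN by (simp add: active_def)
    then have sub: "active z \<subseteq> active z'" using keep by blast
    have v': "section_vertex tight_space z'"
      using z zL zB sub unfolding section_vertex_def by blast
    then have "active z' = active z"
      using sub tight_space_vertex(2)[OF v'] tight_space_vertex(2)[OF z]
      by (intro card_subset_eq[symmetric]) auto
    then have "v j \<bullet> z' = 0" using tight_space_vertex(3)[OF v'] j by auto
    then show False using abs_cz[OF j(1)] j mu \<delta> by simp
  qed
  then have d: "\<delta> = 1 / \<mu>" by (auto simp: \<delta>_def min_def field_simps)
  have jz': "j \<in> active z'"
    using abs_cz[OF j(1)] j mu d by (auto simp: active_def)
  have v': "section_vertex tight_space z'"
    by (rule section_vertexI_exchange[OF z zL zB y(1) y(3) _ keep jz'])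
      (use y(2) j mu in auto)
  have "insert j (active z - {i}) = active z'"
  proof (rule card_subset_eq)
    show "insert j (active z - {i}) \<subseteq> active z'" using keep jz' by blast
    have "card (insert j (active z - {i})) = card (active z)"
      using i j(1) card.remove[OF finite_active i] by simp
    then show "card (insert j (active z - {i})) = card (active z')"
      using tight_space_vertex(2)[OF v'] tight_space_vertex(2)[OF z] by simp
  qed simp
  then have act: "k \<notin> active z'" if "k \<notin> active z - {i}" "k \<noteq> j" for k using that by blast
  have "i \<notin> active z'" using act i j(1) by blast
  then have "v i \<bullet> z' = 0" using tight_space_vertex(3)[OF v'] iN by blast
  then have d1: "\<delta> = 1" using ci zi by auto
  then have "\<bar>v j \<bullet> y\<bar> = 1" using d j mu by (simp add: field_simps)
  moreover have "v k \<bullet> y = 0" if k: "k \<in> N - {i, j}" for k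
  proof (cases "k \<in> active z")
    case True
    then show ?thesis using y(3) k by blast
  next
    case False
    then have "v k \<bullet> z' = 0" using tight_space_vertex(3)[OF v'] act[of k] k by blast
    then show ?thesis using abs_cz[of k] False k d1 by simp
  qed
  ultimately show thesis using that j(1) by blast
qed

text \<open>
  After switching with the signs \<open>s\<close>, the coordinates of \<open>y\<close> are the difference of the \<open>p\<close>-th and the
  \<open>q\<close>-th unit vector. Adding a multiple of \<open>y\<close> to a vertex with inactive coordinate \<open>q\<close> moves the
  entry from \<open>p\<close> to \<open>q\<close>.
\<close>
definition swap_vector :: "('i \<Rightarrow> real) \<Rightarrow> 'i \<Rightarrow> 'i \<Rightarrow> 'a \<Rightarrow> bool" where
  "swap_vector s p q y \<longleftrightarrow> y \<in> tight_space \<and>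
     (\<forall>k\<in>N. s k * (v k \<bullet> y) = (if k = p then 1 else 0) - (if k = q then 1 else 0))"

lemma swap_vector_coord:
  assumes "\<And>k. k \<in> N \<Longrightarrow> s k \<in> {-1, 1}" "swap_vector s p q y" "k \<in> N"
  shows "v k \<bullet> y = s k * ((if k = p then 1 else 0) - (if k = q then 1 else 0))"
proof -
  have "s k * (s k * (v k \<bullet> y)) = v k \<bullet> y" using assms(1)[OF assms(3)] by auto
  moreover have "s k * (v k \<bullet> y) = (if k = p then 1 else 0) - (if k = q then 1 else 0)"
    using assms(2,3) unfolding swap_vector_def by blast
  ultimately show ?thesis by simp
qed

lemma swap_vector_diff:
  "swap_vector s p r y \<Longrightarrow> swap_vector s q r y' \<Longrightarrow> swap_vector s p q (y - y')"
  by (auto simp: swap_vector_def subspace_diff inner_diff_right right_diff_distrib)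

text \<open>
  Every active index \<open>i\<close> of a vertex is tied to one inactive index \<open>\<pi> i\<close>. Inactive indices keep their
  sign, and the sign of an active index is chosen so that the two nonzero coordinates of its dual vector
  become opposite.
\<close>
lemma exists_swap_star:
  obtains z s \<pi> y where "section_vertex tight_space z" "\<And>k. k \<in> N \<Longrightarrow> s k \<in> {-1, 1}"
    "\<And>i. i \<in> active z \<Longrightarrow> \<pi> i \<in> N - active z" "\<And>i. i \<in> active z \<Longrightarrow> swap_vector s i (\<pi> i) (y i)"
proof -
  obtain z where z: "section_vertex tight_space z" using tight_space_has_vertex by blast
  have "\<exists>j y. j \<in> N - active z \<and> y \<in> tight_space \<and> v i \<bullet> y = 1 \<and> \<bar>v j \<bullet> y\<bar> = 1 \<and>
    (\<forall>k\<in>N - {i, j}. v k \<bullet> y = 0)" if i: "i \<in> active z" for i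
    using vertex_dual_vector[OF z i] vertex_dual_vector_partner[OF z i] by metis
  then obtain \<pi> y where py: "\<And>i. i \<in> active z \<Longrightarrow> \<pi> i \<in> N - active z \<and> y i \<in> tight_space \<and> v i \<bullet> y i = 1 \<and>
    \<bar>v (\<pi> i) \<bullet> y i\<bar> = 1 \<and> (\<forall>k\<in>N - {i, \<pi> i}. v k \<bullet> y i = 0)" by metis
  define s where "s k = (if k \<in> active z then - (v (\<pi> k) \<bullet> y k) else 1)" for k
  define y' where "y' i = s i *\<^sub>R y i" for i
  have s: "s k \<in> {-1, 1}" for k
    using py[of k] by (auto simp: s_def abs_if split: if_splits)
  have "swap_vector s i (\<pi> i) (y' i)" if i: "i \<in> active z" for i
    unfolding swap_vector_def
  proof (intro conjI ballI)
    show "y' i \<in> tight_space" using py[OF i] by (simp add: y'_def subspace_scale)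
    fix k assume k: "k \<in> N"
    have ss: "s i * s i = 1" using s[of i] by auto
    have sp: "s (\<pi> i) = 1" using py[OF i] by (simp add: s_def)
    have si: "v (\<pi> i) \<bullet> y i = - s i" using i by (simp add: s_def)
    have ne: "\<pi> i \<noteq> i" using py[OF i] i by auto
    consider "k = i" | "k = \<pi> i" | "k \<in> N - {i, \<pi> i}" using k by blast
    then show "s k * (v k \<bullet> y' i) = (if k = i then 1 else 0) - (if k = \<pi> i then 1 else 0)"
      using py[OF i] ss sp si ne by cases (auto simp: y'_def)
  qed
  then show thesis using that z s py by blast
qed

lemma swap_slide:
  assumes z: "section_vertex tight_space z" and s: "\<And>k. k \<in> N \<Longrightarrow> s k \<in> {-1, 1}"
    and y: "swap_vector s p q y" and p: "p \<in> active z" and q: "q \<in> N - active z"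
  defines "z' \<equiv> z - (s p * (v p \<bullet> z)) *\<^sub>R y"
  shows "section_vertex tight_space z'" and "active z' = insert q (active z - {p})"
    and "\<And>k. k \<in> N - {p, q} \<Longrightarrow> v k \<bullet> z' = v k \<bullet> z"
proof -
  note z0 = tight_space_vertex(3)[OF z]
  have pN: "p \<in> N" and pq: "p \<noteq> q" using p q active_subset by auto
  have s2: "s k * (s k * x) = x" if "k \<in> N" for k x using s[OF that] by auto
  have yk: "v k \<bullet> y = s k * ((if k = p then 1 else 0) - (if k = q then 1 else 0))" if "k \<in> N" for k
    by (rule swap_vector_coord[OF _ y that]) (rule s)
  show same: "v k \<bullet> z' = v k \<bullet> z" if "k \<in> N - {p, q}" for k
    using that yk[of k] by (simp add: z'_def inner_simps)
  have zp: "v p \<bullet> z' = 0"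
    using yk[OF pN] pq s2[OF pN, of "v p \<bullet> z"] by (simp add: z'_def inner_simps mult.commute mult.left_commute)
  have "\<bar>s p\<bar> = 1" "\<bar>s q\<bar> = 1" "\<bar>v p \<bullet> z\<bar> = 1"
    using s[OF pN] s[of q] p q by (auto simp: active_def)
  then have zq: "\<bar>v q \<bullet> z'\<bar> = 1"
    using yk[of q] q z0[OF q] pq by (simp add: z'_def inner_simps abs_mult)
  show act: "active z' = insert q (active z - {p})"
  proof
    show "active z' \<subseteq> insert q (active z - {p})"
    proof
      fix k assume k: "k \<in> active z'"
      then have "k \<noteq> p" using zp by (auto simp: active_def)
      then show "k \<in> insert q (active z - {p})"
        using k same[of k] by (cases "k = q") (auto simp: active_def)
    qed
    show "insert q (active z - {p}) \<subseteq> active z'"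
    proof
      fix k assume "k \<in> insert q (active z - {p})"
      then show "k \<in> active z'"
        using same[of k] zq q by (cases "k = q") (auto simp: active_def)
    qed
  qed
  have "z' \<in> slab_body"
    unfolding slab_body_def
  proof safe
    fix k assume "k \<in> N"
    then show "\<bar>v k \<bullet> z'\<bar> \<le> 1"
      using same[of k] zp zq tight_space_vertex(1)[OF z]
      by (cases "k \<in> {p, q}") (auto simp: slab_body_def)
  qed
  moreover have "y \<in> tight_space" using y by (simp add: swap_vector_def)
  moreover from this have "z' \<in> tight_space"
    using z by (simp add: z'_def section_vertex_def subspace_diff subspace_scale)
  moreover have "v k \<bullet> y = 0" if "k \<in> active z - {p}" for k
    using that q yk[of k] active_subset[of z] by auto
  moreover have "v p \<bullet> y \<noteq> 0" "v q \<bullet> y \<noteq> 0"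
    using yk[OF pN] yk[of q] q pq s[OF pN] s[of q] by auto
  ultimately show "section_vertex tight_space z'"
    using section_vertexI_exchange[OF z, of z' y p q] act by auto
qed

lemma frame_op_swap_vector:
  assumes s: "\<And>k. k \<in> N \<Longrightarrow> s k \<in> {-1, 1}" and y: "swap_vector s p q y" and pq: "p \<in> N" "q \<in> N"
  shows "frame_op y = s p *\<^sub>R v p - s q *\<^sub>R v q"
proof -
  have yk: "v k \<bullet> y = s k * ((if k = p then 1 else 0) - (if k = q then 1 else 0))" if "k \<in> N" for k
    by (rule swap_vector_coord[OF _ y that]) (rule s)
  have "frame_op y = (\<Sum>k\<in>N. (if k = p then s k *\<^sub>R v k else 0) - (if k = q then s k *\<^sub>R v k else 0))"
    unfolding frame_op_def by (intro sum.cong) (auto simp: yk)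
  then show ?thesis using finite_N pq by (simp add: sum_subtractf)
qed

text \<open>
  The zero is moved from \<open>r\<close> to \<open>k\<close> in two ways: directly, and with a detour through \<open>i\<close>. Both final
  vertices have a frame image orthogonal to \<open>v k\<close>, and the difference of the two equations is the
  claim times the difference of the entries at \<open>k\<close> and \<open>i\<close>.
\<close>
lemma opposite_swap_inner_eq:
  assumes z: "section_vertex tight_space z" and s: "\<And>k. k \<in> N \<Longrightarrow> s k \<in> {-1, 1}"
    and r: "r \<in> N - active z" and i: "i \<in> active z" and k: "k \<in> active z"
    and ir: "swap_vector s i r y" and kr: "swap_vector s k r y'"
    and opp: "s i * (v i \<bullet> z) \<noteq> s k * (v k \<bullet> z)"
  shows "(s i *\<^sub>R v i) \<bullet> (s k *\<^sub>R v k) = (s r *\<^sub>R v r) \<bullet> (s k *\<^sub>R v k)"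
proof -
  define a where "a j = s j *\<^sub>R v j" for j
  define xi xk where "xi = s i * (v i \<bullet> z)" and "xk = s k * (v k \<bullet> z)"
  have N: "i \<in> N" "k \<in> N" "r \<in> N" using i k r active_subset by auto
  have ne: "i \<noteq> k" "i \<noteq> r" "k \<noteq> r" using opp i k r by auto
  have S: "frame_op y = a i - a r" "frame_op y' = a k - a r" "frame_op (y' - y) = a k - a i"
    using frame_op_swap_vector[OF s ir] frame_op_swap_vector[OF s kr] N
      frame_op_swap_vector[OF s swap_vector_diff[OF kr ir]] by (simp_all add: a_def)
  \<comment> \<open>\<open>z1\<close>: the zero moves directly to \<open>k\<close>\<close>
  define z1 where "z1 = z - xk *\<^sub>R y'"
  have "section_vertex tight_space z1" "active z1 = insert r (active z - {k})"
    using swap_slide[OF z s kr k r] by (simp_all add: z1_def xk_def)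
  then have "frame_op z1 \<bullet> a k = 0"
    using vertex_inactive_orthogonal_sum[of z1 k] N ne by (simp add: a_def)
  then have e1: "(frame_op z - xk *\<^sub>R (a k - a r)) \<bullet> a k = 0"
    by (simp add: z1_def frame_op_diff frame_op_scale S)
  \<comment> \<open>\<open>z2\<close> and \<open>z3\<close>: the zero moves to \<open>i\<close> and from there to \<open>k\<close>\<close>
  define z2 where "z2 = z - xi *\<^sub>R y"
  have z2: "section_vertex tight_space z2" "active z2 = insert r (active z - {i})" "v k \<bullet> z2 = v k \<bullet> z"
    using swap_slide[OF z s ir i r] ne N by (simp_all add: z2_def xi_def)
  define z3 where "z3 = z2 - xk *\<^sub>R (y' - y)"
  have "section_vertex tight_space z3" "active z3 = insert i (active z2 - {k})"
    using swap_slide[OF z2(1) s swap_vector_diff[OF kr ir], of] z2 k ne N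
    by (simp_all add: z3_def xk_def)
  then have "frame_op z3 \<bullet> a k = 0"
    using vertex_inactive_orthogonal_sum[of z3 k] N ne by (simp add: a_def)
  then have e2: "(frame_op z - xi *\<^sub>R (a i - a r) - xk *\<^sub>R (a k - a i)) \<bullet> a k = 0"
    by (simp add: z3_def z2_def frame_op_diff[of "z - xi *\<^sub>R y"] frame_op_diff[of z] frame_op_scale S)
  have "(xk - xi) * (a i \<bullet> a k - a r \<bullet> a k) = 0"
    using e1 e2 by (simp add: inner_simps algebra_simps)
  moreover have "xk \<noteq> xi" using opp by (simp add: xi_def xk_def)
  ultimately show ?thesis by (simp add: a_def)
qed

end


section \<open>Blocks of indices\<close>

lemma sum_signs_zero_even:
  assumes "finite F" "\<And>i. i \<in> F \<Longrightarrow> f i \<in> {-1, 1::real}" "(\<Sum>i\<in>F. f i) = 0"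
  shows "even (card F)"
proof -
  define P where "P = {i \<in> F. f i = 1}"
  have P: "P \<subseteq> F" "finite P" using assms(1) by (auto simp: P_def)
  have "(\<Sum>i\<in>F. f i) = (\<Sum>i\<in>P. f i) + (\<Sum>i\<in>F - P. f i)"
    using sum.subset_diff[OF P(1) assms(1), of f] by simp
  also have "(\<Sum>i\<in>P. f i) = real (card P)" by (simp add: P_def)
  also have "(\<Sum>i\<in>F - P. f i) = - real (card (F - P))"
  proof -
    have "f i = -1" if "i \<in> F - P" for i using assms(2)[of i] that by (auto simp: P_def)
    then show ?thesis by simp
  qed
  finally have "card P = card (F - P)" using assms(3) by simp
  moreover have "card F = card P + card (F - P)"
    using P assms(1) by (metis card_Diff_subset card_mono le_add_diff_inverse)
  ultimately show ?thesis by simp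
qed

locale swap_star = bounded_signed_sums_eigen v N B \<sigma>
  for v :: "'i \<Rightarrow> 'a::euclidean_space" and N B \<sigma> +
  fixes z :: 'a and s :: "'i \<Rightarrow> real" and \<pi> :: "'i \<Rightarrow> 'i" and y :: "'i \<Rightarrow> 'a"
  assumes vertex: "section_vertex tight_space z"
    and signs: "\<And>k. k \<in> N \<Longrightarrow> s k \<in> {-1, 1}"
    and centre: "\<And>i. i \<in> active z \<Longrightarrow> \<pi> i \<in> N - active z"
    and swap: "\<And>i. i \<in> active z \<Longrightarrow> swap_vector s i (\<pi> i) (y i)"
begin

definition switched :: "'i \<Rightarrow> 'a" where "switched k = s k *\<^sub>R v k"

definition coord :: "'i \<Rightarrow> real" where "coord k = s k * (v k \<bullet> z)"

definition fibre :: "'i \<Rightarrow> 'i set" where "fibre j = {i \<in> active z. \<pi> i = j}"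

definition block :: "'i \<Rightarrow> 'i set" where "block j = insert j (fibre j)"

definition block_centre :: "'i \<Rightarrow> 'i" where "block_centre k = (if k \<in> active z then \<pi> k else k)"

lemma active_N: "i \<in> active z \<Longrightarrow> i \<in> N"
  using active_subset by blast

lemma finite_fibre [simp]: "finite (fibre j)"
  by (simp add: fibre_def)

lemma centre_neq: "i \<in> active z \<Longrightarrow> i \<noteq> \<pi> i"
  using centre by (metis DiffE)

lemma centre_notin_fibre: "j \<notin> active z \<Longrightarrow> j \<notin> fibre j"
  by (simp add: fibre_def)

lemma block_iff: "j \<in> N - active z \<Longrightarrow> k \<in> N \<Longrightarrow> k \<in> block j \<longleftrightarrow> block_centre k = j"
  using centre by (auto simp: block_def fibre_def block_centre_def)

lemma block_subset: "j \<in> N - active z \<Longrightarrow> block j \<subseteq> N"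
  using active_N by (auto simp: block_def fibre_def)

lemma norm_switched: "k \<in> N \<Longrightarrow> norm (switched k) = 1"
  using signs[of k] unit[of k] by (auto simp: switched_def)

lemma switched_inner_self: "k \<in> N \<Longrightarrow> switched k \<bullet> switched k = 1"
  using norm_switched by (simp add: norm_eq_1)

lemma coord_sign: "i \<in> active z \<Longrightarrow> coord i \<in> {-1, 1}"
  using signs[of i] active_N[of i] by (auto simp: coord_def active_def abs_if split: if_splits)

lemma frame_op_switched: "frame_op w = (\<Sum>k\<in>N. (switched k \<bullet> w) *\<^sub>R switched k)"
  unfolding frame_op_def
proof (intro sum.cong refl)
  fix k assume "k \<in> N"
  then show "(v k \<bullet> w) *\<^sub>R v k = (switched k \<bullet> w) *\<^sub>R switched k" using signs[of k] by (auto simp: switched_def)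
qed

lemma slide:
  assumes "i \<in> active z"
  shows "section_vertex tight_space (z - coord i *\<^sub>R y i)"
    and "active (z - coord i *\<^sub>R y i) = insert (\<pi> i) (active z - {i})"
    and "\<And>k. k \<in> N - {i, \<pi> i} \<Longrightarrow> v k \<bullet> (z - coord i *\<^sub>R y i) = v k \<bullet> z"
  using swap_slide[OF vertex signs swap[OF assms] assms centre[OF assms]] by (simp_all add: coord_def)

text \<open>
  At most two slides lead to a vertex at which both coordinates are \<open>0\<close>, and there the vectors are
  orthogonal.
\<close>
lemma block_orthogonal:
  assumes pq: "p \<in> N" "q \<in> N" "block_centre p \<noteq> block_centre q"
  shows "switched p \<bullet> switched q = 0"
proof -
  have one: "switched p \<bullet> switched q = 0"
    if p: "p \<in> active z" and q: "q \<in> N - active z" "q \<noteq> \<pi> p" for p q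
  proof -
    have "p \<in> N - active (z - coord p *\<^sub>R y p)"
      unfolding slide(2)[OF p] using active_N[OF p] centre_neq[OF p] by simp
    moreover have "q \<in> N - active (z - coord p *\<^sub>R y p)"
      unfolding slide(2)[OF p] using q by blast
    moreover have "p \<noteq> q" using p q by blast
    ultimately have "v p \<bullet> v q = 0" by (rule vertex_inactive_orthogonal[OF slide(1)[OF p]])
    then show ?thesis by (simp add: switched_def)
  qed
  show ?thesis
  proof (cases "p \<in> active z"; cases "q \<in> active z")
    assume p: "p \<in> active z" and q: "q \<in> active z"
    have ne: "\<pi> p \<noteq> \<pi> q" "p \<noteq> q" using pq p q by (auto simp: block_centre_def)
    define z1 where "z1 = z - coord p *\<^sub>R y p"
    have z1: "section_vertex tight_space z1" "active z1 = insert (\<pi> p) (active z - {p})"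
      using slide[OF p] by (simp_all add: z1_def)
    have "q \<in> active z1" "\<pi> q \<in> N - active z1"
      using z1(2) q ne centre[OF q] by auto
    then have "section_vertex tight_space (z1 - (s q * (v q \<bullet> z1)) *\<^sub>R y q)"
      "active (z1 - (s q * (v q \<bullet> z1)) *\<^sub>R y q) = insert (\<pi> q) (active z1 - {q})"
      using swap_slide[OF z1(1) signs swap[OF q]] by simp_all
    moreover have "p \<in> N - insert (\<pi> q) (active z1 - {q})" "q \<in> N - insert (\<pi> q) (active z1 - {q})"
      using z1(2) p q ne pq(1,2) centre[OF p] centre[OF q] by auto
    ultimately have "v p \<bullet> v q = 0" using vertex_inactive_orthogonal ne(2) by metis
    then show ?thesis by (simp add: switched_def)
  next
    assume "p \<in> active z" "q \<notin> active z"
    then show ?thesis using one[of p q] pq by (auto simp: block_centre_def)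
  next
    assume "p \<notin> active z" "q \<in> active z"
    then show ?thesis using one[of q p] pq by (auto simp: block_centre_def inner_commute)
  next
    assume "p \<notin> active z" "q \<notin> active z"
    then have "v p \<bullet> v q = 0"
      using vertex_inactive_orthogonal[OF vertex, of p q] pq by (auto simp: block_centre_def)
    then show ?thesis by (simp add: switched_def)
  qed
qed

text \<open>
  A vector of the tight space is determined by its active coordinates.
\<close>
lemma vertex_expansion: "z = (\<Sum>i\<in>active z. coord i *\<^sub>R y i)"
proof -
  define u where "u = z - (\<Sum>i\<in>active z. coord i *\<^sub>R y i)"
  have "u \<in> tight_space"
    unfolding u_def using vertex swap
    by (intro subspace_diff subspace_sum subspace_scale)
      (auto simp: section_vertex_def swap_vector_def)
  moreover have "v k \<bullet> u = 0" if k: "k \<in> active z" for k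
  proof -
    have "s k * (v k \<bullet> (\<Sum>i\<in>active z. coord i *\<^sub>R y i)) = (\<Sum>i\<in>active z. coord i * (s k * (v k \<bullet> y i)))"
      by (simp add: inner_sum_right sum_distrib_left algebra_simps)
    also have "\<dots> = (\<Sum>i\<in>active z. if i = k then coord i else 0)"
    proof (intro sum.cong refl)
      fix i assume i: "i \<in> active z"
      have "s k * (v k \<bullet> y i) = (if k = i then 1 else 0) - (if k = \<pi> i then 1 else 0)"
        using swap[OF i] active_N[OF k] unfolding swap_vector_def by blast
      moreover have "k \<noteq> \<pi> i" using centre[OF i] k by blast
      ultimately show "coord i * (s k * (v k \<bullet> y i)) = (if i = k then coord i else 0)" by auto
    qed
    also have "\<dots> = s k * (v k \<bullet> z)" using k by (simp add: coord_def)
    finally show ?thesis using signs[OF active_N[OF k]] by (auto simp: u_def inner_simps)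
  qed
  ultimately have "u = 0" using vertex unfolding section_vertex_def by blast
  then show ?thesis by (simp add: u_def)
qed

text \<open>
  The coordinate of the vertex at the inactive index \<open>j\<close> is \<open>0\<close>; by the expansion above it is also
  minus the sum over the fibre.
\<close>
lemma sum_fibre_coord:
  assumes j: "j \<in> N - active z"
  shows "(\<Sum>i\<in>fibre j. coord i) = 0"
proof -
  have "0 = s j * (v j \<bullet> z)" using tight_space_vertex(3)[OF vertex j] by simp
  also have "\<dots> = (\<Sum>i\<in>active z. coord i * (s j * (v j \<bullet> y i)))"
    by (subst vertex_expansion) (simp add: inner_sum_right sum_distrib_left algebra_simps)
  also have "\<dots> = (\<Sum>i\<in>active z. if \<pi> i = j then - coord i else 0)"
  proof (intro sum.cong refl)
    fix i assume i: "i \<in> active z"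
    have "s j * (v j \<bullet> y i) = (if j = i then 1 else 0) - (if j = \<pi> i then 1 else 0)"
      using swap[OF i] j unfolding swap_vector_def by blast
    moreover have "j \<noteq> i" using i j by blast
    ultimately show "coord i * (s j * (v j \<bullet> y i)) = (if \<pi> i = j then - coord i else 0)" by auto
  qed
  also have "\<dots> = - (\<Sum>i\<in>fibre j. coord i)"
    by (simp add: fibre_def sum.inter_filter[symmetric] sum_negf)
  finally show ?thesis by simp
qed

lemma even_card_fibre: "j \<in> N - active z \<Longrightarrow> even (card (fibre j))"
  using sum_signs_zero_even[OF finite_fibre, of j coord] coord_sign sum_fibre_coord by (auto simp: fibre_def)

lemma opposite_in_fibre:
  assumes j: "j \<in> N - active z" and i: "i \<in> fibre j"
  obtains k where "k \<in> fibre j" "coord k = - coord i"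
proof (rule ccontr)
  assume "\<not> thesis"
  then have no: "\<And>k. k \<in> fibre j \<Longrightarrow> coord k \<noteq> - coord i" using that by blast
  have "coord k = coord i" if "k \<in> fibre j" for k
    using no[OF that] that coord_sign[of k] coord_sign[of i] i by (auto simp: fibre_def)
  then have "(\<Sum>k\<in>fibre j. coord k) = real (card (fibre j)) * coord i" by simp
  moreover have "card (fibre j) > 0" using i by (auto simp: card_gt_0_iff)
  moreover have "coord i \<noteq> 0" using coord_sign[of i] i by (auto simp: fibre_def)
  ultimately show False using sum_fibre_coord[OF j] by simp
qed

lemma opposite_inner:
  assumes "i \<in> fibre j" "k \<in> fibre j" "coord k = - coord i"
  shows "switched i \<bullet> switched k = switched j \<bullet> switched k"
proof -
  have i: "i \<in> active z" "\<pi> i = j" and k: "k \<in> active z" "\<pi> k = j"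
    using assms by (auto simp: fibre_def)
  have "s i * (v i \<bullet> z) \<noteq> s k * (v k \<bullet> z)"
    using assms(3) coord_sign[OF i(1)] by (auto simp: coord_def)
  then show ?thesis
    using opposite_swap_inner_eq[OF vertex signs centre[OF i(1)] i(1) k(1) swap[OF i(1)]] swap[OF k(1)] i k
    by (simp add: switched_def)
qed

lemma fibre_centre_inner:
  assumes j: "j \<in> N - active z" and i: "i \<in> fibre j" and k: "k \<in> fibre j"
  shows "switched j \<bullet> switched i = switched j \<bullet> switched k"
proof -
  have opp: "switched j \<bullet> switched i = switched j \<bullet> switched k" if "i \<in> fibre j" "k \<in> fibre j" "coord k = - coord i" for i k
    using opposite_inner[of i j k] opposite_inner[of k j i] that by (simp add: inner_commute)
  obtain l where l: "l \<in> fibre j" "coord l = - coord i" using opposite_in_fibre[OF j i] .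
  have "coord k = - coord i \<or> coord l = - coord k"
    using l coord_sign[of i] coord_sign[of k] i k by (auto simp: fibre_def)
  then show ?thesis
    using opp[of i k] opp[of k l] opp[of i l] i k l by auto
qed

text \<open>
  For opposite entries this is the two-way slide at \<open>z\<close>. For equal entries, first slide \<open>i\<close> into the
  centre and compare with an entry \<open>l\<close> of the opposite sign at the new vertex.
\<close>
lemma fibre_inner:
  assumes j: "j \<in> N - active z" and i: "i \<in> fibre j" and k: "k \<in> fibre j" and "i \<noteq> k"
  shows "switched i \<bullet> switched k = switched j \<bullet> switched k"
proof (cases "coord k = - coord i")
  case True
  then show ?thesis using opposite_inner i k by blast
next
  case False
  have act: "i \<in> active z" "k \<in> active z" "\<pi> i = j" "\<pi> k = j" using i k by (auto simp: fibre_def)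
  obtain l where l: "l \<in> fibre j" "coord l = - coord k" using opposite_in_fibre[OF j k] .
  have lact: "l \<in> active z" "\<pi> l = j" using l by (auto simp: fibre_def)
  have ne: "l \<noteq> k" "l \<noteq> i" using l False coord_sign[OF act(2)] by auto
  define z1 where "z1 = z - coord i *\<^sub>R y i"
  have z1: "section_vertex tight_space z1" "active z1 = insert j (active z - {i})"
    "v k \<bullet> z1 = v k \<bullet> z" "v l \<bullet> z1 = v l \<bullet> z"
    using slide[OF act(1)] act ne active_N \<open>i \<noteq> k\<close> centre[OF act(1)] lact
    by (auto simp: z1_def)
  have sw: "swap_vector s l i (y l - y i)" "swap_vector s k i (y k - y i)"
    using swap_vector_diff swap act lact by metis+
  have "s l * (v l \<bullet> z1) \<noteq> s k * (v k \<bullet> z1)"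
    using l(2) coord_sign[OF act(2)] z1 by (auto simp: coord_def)
  moreover have "i \<in> N - active z1" "l \<in> active z1" "k \<in> active z1"
    using z1(2) act active_N lact ne \<open>i \<noteq> k\<close> j by auto
  ultimately have "switched l \<bullet> switched k = switched i \<bullet> switched k"
    using opposite_swap_inner_eq[OF z1(1) signs _ _ _ sw] by (simp add: switched_def)
  moreover have "switched l \<bullet> switched k = switched j \<bullet> switched k"
    using opposite_inner[of l j k] l k by simp
  ultimately show ?thesis by simp
qed

text \<open>
  With all inner products equal to \<open>- g\<close>, the sum \<open>w\<close> of a block satisfies \<open>S w = c w\<close> with
  \<open>c = 1 - (b - 1) g\<close>, where \<open>b\<close> is the size of the block. As \<open>g > 0\<close>, this is below \<open>1\<close>, and no eigenvalue of
  \<open>S\<close> is, so \<open>w = 0\<close>. Then \<open>c\<close>, which is the inner product of \<open>w\<close> with a vector of the block, is \<open>0\<close> too.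
\<close>
lemma block_simplex:
  assumes j: "j \<in> N - active z" and ne: "fibre j \<noteq> {}"
  obtains g where "0 < g" "real (card (fibre j)) * g = 1" "(\<Sum>k\<in>block j. switched k) = 0"
    "\<And>p q. p \<in> block j \<Longrightarrow> q \<in> block j \<Longrightarrow> p \<noteq> q \<Longrightarrow> switched p \<bullet> switched q = - g"
proof -
  obtain i where i: "i \<in> fibre j" using ne by blast
  have iz: "i \<in> active z" "\<pi> i = j" using i by (auto simp: fibre_def)
  define g where "g = - (switched j \<bullet> switched i)"
  have inner: "switched p \<bullet> switched q = - g" if "p \<in> block j" "q \<in> block j" "p \<noteq> q" for p q
  proof -
    have jk: "switched j \<bullet> switched k = - g" if "k \<in> fibre j" for k
      using fibre_centre_inner[OF j that i] by (simp add: g_def)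
    consider "p = j" "q \<in> fibre j" | "q = j" "p \<in> fibre j" | "p \<in> fibre j" "q \<in> fibre j"
      using \<open>p \<in> block j\<close> \<open>q \<in> block j\<close> \<open>p \<noteq> q\<close> by (auto simp: block_def)
    then show ?thesis
      using jk fibre_inner[OF j _ _ \<open>p \<noteq> q\<close>] by cases (metis inner_commute)+
  qed
  have iN: "i \<in> N" and jN: "j \<in> N" and ij: "i \<noteq> j" using iz active_N j by auto
  have "0 < g"
  proof -
    have yi: "swap_vector s i j (y i)" using swap[OF iz(1)] iz by simp
    have yk: "v k \<bullet> y i = s k * ((if k = i then 1 else 0) - (if k = j then 1 else 0))" if "k \<in> N" for k
      by (rule swap_vector_coord[OF _ yi that]) (rule signs)
    have "(v k \<bullet> y i)\<^sup>2 = (if k = i then 1 else 0) + (if k = j then 1 else 0)" if "k \<in> N" for k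
      using yk[OF that] signs[OF that] ij by (auto simp: power2_eq_square)
    then have "(\<Sum>k\<in>N. (v k \<bullet> y i)\<^sup>2) = 2"
      using finite_N iN jN by (simp add: sum.distrib)
    moreover have "y i \<noteq> 0" using yk[OF iN] signs[OF iN] ij by auto
    moreover have "y i \<in> tight_space" using yi by (simp add: swap_vector_def)
    ultimately have "2 < (norm (frame_op (y i)))\<^sup>2" using tight_space_expands by metis
    also have "frame_op (y i) = switched i - switched j"
      using frame_op_swap_vector[OF signs yi iN jN] by (simp add: switched_def)
    also have "(norm (switched i - switched j))\<^sup>2 = 2 + 2 * g"
      unfolding power2_norm_eq_inner using switched_inner_self[OF iN] switched_inner_self[OF jN]
      by (simp add: inner_simps inner_commute g_def)
    finally show ?thesis by simp
  qed
  have fin: "finite (block j)" by (simp add: block_def)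
  have cb: "card (block j) = card (fibre j) + 1"
    using centre_notin_fibre j by (simp add: block_def)
  define w where "w = (\<Sum>k\<in>block j. switched k)"
  define c where "c = 1 - real (card (fibre j)) * g"
  have aw: "switched k \<bullet> w = (if k \<in> block j then c else 0)" if k: "k \<in> N" for k
  proof (cases "k \<in> block j")
    case True
    have "switched k \<bullet> w = switched k \<bullet> switched k + (\<Sum>l\<in>block j - {k}. switched k \<bullet> switched l)"
      unfolding w_def inner_sum_right using fin True by (rule sum.remove)
    also have "(\<Sum>l\<in>block j - {k}. switched k \<bullet> switched l) = (\<Sum>l\<in>block j - {k}. - g)"
      using True inner by (intro sum.cong) auto
    finally show ?thesis
      using True cb fin k by (simp add: c_def switched_inner_self)
  next
    case False
    have "switched k \<bullet> switched l = 0" if "l \<in> block j" for l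
      using block_orthogonal[OF k, of l] block_iff[OF j k] block_iff[OF j, of l] False that
        block_subset[OF j] by auto
    then show ?thesis using False by (simp add: w_def inner_sum_right)
  qed
  have "frame_op w = (\<Sum>k\<in>N. (switched k \<bullet> w) *\<^sub>R switched k)" by (rule frame_op_switched)
  also have "\<dots> = (\<Sum>k\<in>block j. c *\<^sub>R switched k)"
    using block_subset[OF j] finite_N by (intro sum.mono_neutral_cong_right) (auto simp: aw)
  also have "\<dots> = c *\<^sub>R w" by (simp add: w_def scaleR_sum_right)
  finally have "w \<bullet> w \<le> c * (w \<bullet> w)" using frame_op_ge[of w] by simp
  then have "(1 - c) * (w \<bullet> w) \<le> 0" by (simp add: algebra_simps)
  moreover have "1 - c > 0"
  proof -
    have "0 < card (fibre j)" using i by (auto simp: card_gt_0_iff)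
    then show ?thesis using \<open>0 < g\<close> by (simp add: c_def)
  qed
  ultimately have "w \<bullet> w \<le> 0" by (simp add: mult_le_0_iff)
  then have w0: "w = 0" by (metis inner_ge_zero inner_eq_zero_iff antisym)
  then have "c = 0" using aw[OF jN] by (simp add: block_def)
  then show thesis
    using that[of g] \<open>0 < g\<close> inner w0 by (simp add: c_def w_def)
qed

text \<open>
  The vertex attains \<open>\<parallel>S z\<parallel>\<^sup>2 - z \<bullet> S z = n - d\<close>. Evaluated in coordinates, an active index
  contributes the number \<open>g\<close> of its block, so that each block contributes \<open>(b - 1) g = 1\<close>.
\<close>
lemma card_centres: "real (card (\<pi> ` active z)) = real (card N) - real (DIM('a))"
proof -
  note z0 = tight_space_vertex(3)[OF vertex]
  have summand: "(v i \<bullet> z) * (v i \<bullet> frame_op z) = 1 - switched i \<bullet> switched (\<pi> i)" if i: "i \<in> active z" for i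
  proof -
    have N: "i \<in> N" "\<pi> i \<in> N" "i \<noteq> \<pi> i" using active_N[OF i] centre[OF i] i by auto
    have "frame_op (z - coord i *\<^sub>R y i) \<bullet> v i = 0"
      using vertex_inactive_orthogonal_sum[OF slide(1)[OF i], of i] slide(2)[OF i] N by simp
    moreover have "frame_op (y i) = switched i - switched (\<pi> i)"
      using frame_op_swap_vector[OF signs swap[OF i] N(1,2)] by (simp add: switched_def)
    ultimately have "(frame_op z - coord i *\<^sub>R (switched i - switched (\<pi> i))) \<bullet> switched i = 0"
      by (simp add: frame_op_diff frame_op_scale switched_def)
    then have "frame_op z \<bullet> switched i = coord i * (1 - switched i \<bullet> switched (\<pi> i))"
      using switched_inner_self[OF N(1)] by (simp add: inner_simps inner_commute algebra_simps)
    moreover have "(v i \<bullet> z) * (v i \<bullet> frame_op z) = coord i * (frame_op z \<bullet> switched i)"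
      using signs[OF N(1)] by (auto simp: coord_def switched_def inner_commute)
    ultimately show ?thesis using coord_sign[OF i] by auto
  qed
  have "(norm (frame_op z))\<^sup>2 = (\<Sum>i\<in>N. (v i \<bullet> z) * (v i \<bullet> frame_op z))"
    by (simp only: power2_norm_eq_inner frame_op_self_adjoint inner_frame_op[of z "frame_op z"])
  also have "\<dots> = (\<Sum>i\<in>active z. (v i \<bullet> z) * (v i \<bullet> frame_op z))"
    using finite_N active_subset z0 by (intro sum.mono_neutral_right) auto
  also have "\<dots> = (\<Sum>i\<in>active z. 1 - switched i \<bullet> switched (\<pi> i))" by (simp add: summand)
  finally have n: "(norm (frame_op z))\<^sup>2 = real (card (active z)) + (\<Sum>i\<in>active z. - (switched i \<bullet> switched (\<pi> i)))"
    by (simp add: sum_subtractf sum_negf)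
  have "z \<bullet> frame_op z = (\<Sum>i\<in>active z. (v i \<bullet> z)\<^sup>2)"
    unfolding inner_frame_op_self
    using finite_N active_subset z0 by (intro sum.mono_neutral_right) auto
  then have "(\<Sum>i\<in>active z. - (switched i \<bullet> switched (\<pi> i))) = real (card N) - real (DIM('a))"
    using n tight_space_vertex(4)[OF vertex] by (simp add: sum_active)
  moreover have "(\<Sum>i\<in>active z. - (switched i \<bullet> switched (\<pi> i))) = (\<Sum>j\<in>\<pi> ` active z. \<Sum>i\<in>fibre j. - (switched i \<bullet> switched (\<pi> i)))"
    unfolding fibre_def by (rule sum.image_gen) simp
  moreover have "(\<Sum>i\<in>fibre j. - (switched i \<bullet> switched (\<pi> i))) = 1" if j: "j \<in> \<pi> ` active z" for j
  proof -
    have jN: "j \<in> N - active z" and ne: "fibre j \<noteq> {}" using j centre by (auto simp: fibre_def)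
    obtain g where g: "real (card (fibre j)) * g = 1"
      "\<And>p q. p \<in> block j \<Longrightarrow> q \<in> block j \<Longrightarrow> p \<noteq> q \<Longrightarrow> switched p \<bullet> switched q = - g"
      using block_simplex[OF jN ne] by metis
    have "- (switched i \<bullet> switched (\<pi> i)) = g" if "i \<in> fibre j" for i
      using g(2)[of i j] that centre_neq[of i] by (auto simp: block_def fibre_def)
    then show ?thesis using g(1) by simp
  qed
  ultimately show ?thesis by simp
qed

end


section \<open>The orthogonal decomposition into simplices\<close>

text \<open>
  Taking the inner product of an affine dependence \<open>U\<close> with a vertex \<open>x\<close> leaves \<open>(1 + g) U x = 0\<close>. The
  barycentre \<open>0\<close> lies in the affine hull, so the linear and the affine dimension agree.
\<close>
lemma centered_regular_simplex_of_inner: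
  fixes C :: "'a::euclidean_space set"
  assumes fin: "finite C" and ne: "C \<noteq> {}" and g: "0 < g"
    and unit: "\<And>x. x \<in> C \<Longrightarrow> norm x = 1"
    and inner: "\<And>x y. x \<in> C \<Longrightarrow> y \<in> C \<Longrightarrow> x \<noteq> y \<Longrightarrow> x \<bullet> y = - g"
    and sum0: "(\<Sum>x\<in>C. x) = 0"
  shows "centered_regular_simplex_vertices (span C) C"
proof -
  have indep: "\<not> affine_dependent C"
  proof
    assume "affine_dependent C"
    then obtain U x where U: "sum U C = 0" "x \<in> C" "U x \<noteq> 0" "(\<Sum>y\<in>C. U y *\<^sub>R y) = 0"
      using affine_dependent_explicit_finite[OF fin] by blast
    have "0 = (\<Sum>y\<in>C. U y *\<^sub>R y) \<bullet> x" using U(4) by simp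
    also have "\<dots> = (\<Sum>y\<in>C. U y * (y \<bullet> x))" by (simp add: inner_sum_left)
    also have "\<dots> = U x * (x \<bullet> x) + (\<Sum>y\<in>C - {x}. U y * (y \<bullet> x))"
      using fin U(2) by (rule sum.remove)
    also have "(\<Sum>y\<in>C - {x}. U y * (y \<bullet> x)) = (\<Sum>y\<in>C - {x}. - g * U y)"
      using U(2) inner by (intro sum.cong) auto
    also have "\<dots> = - g * (\<Sum>y\<in>C - {x}. U y)" by (simp add: sum_distrib_left)
    also have "(\<Sum>y\<in>C - {x}. U y) = - U x"
      using U(1) sum.remove[OF fin U(2), of U] by simp
    also have "x \<bullet> x = 1" using unit[OF U(2)] by (simp add: norm_eq_1)
    finally have "U x * (1 + g) = 0" by (simp add: algebra_simps)
    then show False using g U(3) by simp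
  qed
  have "0 \<in> affine hull C"
  proof -
    have "(\<Sum>x\<in>C. 1 / real (card C)) = 1" using fin ne by simp
    moreover have "(\<Sum>x\<in>C. (1 / real (card C)) *\<^sub>R x) = 0"
      using sum0 by (simp only: scaleR_sum_right[symmetric] scaleR_zero_right)
    ultimately show ?thesis
      unfolding affine_hull_finite[OF fin] by (intro CollectI exI[of _ "\<lambda>_. 1 / real (card C)"]) simp
  qed
  then have "aff_dim C = int (dim C)" by (rule aff_dim_zero)
  moreover have "int (card C) = aff_dim C + 1" using indep by (rule aff_dim_affine_independent)
  ultimately have "card C = dim (span C) + 1" by simp
  moreover have "dist x y = sqrt (2 + 2 * g)" if "x \<in> C" "y \<in> C" "x \<noteq> y" for x y
  proof -
    have "(norm (x - y))\<^sup>2 = 2 + 2 * g"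
      unfolding power2_norm_eq_inner
      using inner[OF that] unit[OF that(1)] unit[OF that(2)]
      by (simp add: inner_simps inner_commute norm_eq_1)
    then show ?thesis by (metis dist_norm norm_ge_zero real_sqrt_unique)
  qed
  ultimately show ?thesis
    using fin indep unit sum0
    by (auto simp: centered_regular_simplex_vertices_def span_base)
qed

lemma orthogonal_spans:
  assumes "\<And>x y. x \<in> A \<Longrightarrow> y \<in> C \<Longrightarrow> x \<bullet> y = 0" "x \<in> span A" "y \<in> span C"
  shows "orthogonal x y"
proof -
  have "orthogonal x' y" if "x' \<in> A" for x'
    by (rule orthogonal_to_span[OF assms(3)]) (use assms(1) that in \<open>simp add: orthogonal_def\<close>)
  then have "orthogonal y x"
    by (intro orthogonal_to_span[OF assms(2)]) (simp add: orthogonal_commute)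
  then show ?thesis by (simp add: orthogonal_commute)
qed

context swap_star begin

lemma simplex_block:
  assumes j: "j \<in> \<pi> ` active z"
  shows "inj_on switched (block j)" "centered_regular_simplex_vertices (span (switched ` block j)) (switched ` block j)"
    "dim (span (switched ` block j)) = card (fibre j)" "card (fibre j) > 0" "even (card (fibre j))"
proof -
  have jN: "j \<in> N - active z" and ne: "fibre j \<noteq> {}" using j centre by (auto simp: fibre_def)
  obtain g where g: "0 < g" "(\<Sum>k\<in>block j. switched k) = 0"
    "\<And>p q. p \<in> block j \<Longrightarrow> q \<in> block j \<Longrightarrow> p \<noteq> q \<Longrightarrow> switched p \<bullet> switched q = - g"
    using block_simplex[OF jN ne] by metis
  have norm1: "norm (switched k) = 1" if "k \<in> block j" for k
    using block_subset[OF jN] that norm_switched by blast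
  show inj: "inj_on switched (block j)"
  proof (rule inj_onI, rule ccontr)
    fix p q assume pq: "p \<in> block j" "q \<in> block j" "switched p = switched q" "p \<noteq> q"
    then have "switched p \<bullet> switched p = - g" using g(3)[of p q] by simp
    then show False using g(1) inner_ge_zero[of "switched p"] by simp
  qed
  show simplex: "centered_regular_simplex_vertices (span (switched ` block j)) (switched ` block j)"
  proof (rule centered_regular_simplex_of_inner[OF _ _ g(1)])
    show "(\<Sum>x\<in>switched ` block j. x) = 0" using g(2) by (simp add: sum.reindex[OF inj])
  qed (use g(3) norm1 in \<open>auto simp: block_def\<close>)
  have "card (switched ` block j) = card (fibre j) + 1"
    using centre_notin_fibre[of j] jN by (simp add: card_image[OF inj]) (simp add: block_def)
  then show "dim (span (switched ` block j)) = card (fibre j)"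
    using simplex by (simp add: centered_regular_simplex_vertices_def)
  show "card (fibre j) > 0" using ne by (simp add: card_gt_0_iff)
  show "even (card (fibre j))" using even_card_fibre[OF jN] .
qed

text \<open>
  Index \<open>0\<close> collects the inactive indices with empty fibre, whose vectors are orthogonal to all others.
  The remaining blocks are enumerated by their centres. The decomposition of a vector comes from
  the surjectivity of \<open>S\<close>.
\<close>
lemma simplex_decomposition:
  obtains V :: "nat \<Rightarrow> 'a set" and I :: "nat \<Rightarrow> 'i set" where
    "orthogonal_decomposition (card (\<pi> ` active z)) V"
    "\<And>j. j \<in> {1..card (\<pi> ` active z)} \<Longrightarrow> dim (V j) > 0 \<and> even (dim (V j))"
    "disjoint_family_on I {0..card (\<pi> ` active z)}"
    "(\<Union>j\<in>{0..card (\<pi> ` active z)}. I j) = N"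
    "\<And>j. j \<in> {0..card (\<pi> ` active z)} \<Longrightarrow> inj_on switched (I j)"
    "orthonormal_basis_of (V 0) (switched ` I 0)"
    "\<And>j. j \<in> {1..card (\<pi> ` active z)} \<Longrightarrow> centered_regular_simplex_vertices (V j) (switched ` I j)"
proof -
  define J where "J = \<pi> ` active z"
  define m where "m = card J"
  have finJ: "finite J" by (simp add: J_def)
  have JN: "J \<subseteq> N - active z" using centre by (auto simp: J_def)
  obtain h where h: "bij_betw h {1..m} J"
    using ex_bij_betw_nat_finite_1[OF finJ] by (auto simp: m_def)
  define R where "R = {k \<in> N. block_centre k \<notin> J}"
  define I where "I j = (if j = 0 then R else block (h j))" for j
  define V where "V j = span (switched ` I j)" for j
  have hJ: "h j \<in> J" if "j \<in> {1..m}" for j using h that by (auto simp: bij_betw_def)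
  have hN: "h j \<in> N - active z" if "j \<in> {1..m}" for j using hJ[OF that] JN by blast
  have Iiff: "k \<in> I j \<longleftrightarrow> block_centre k = h j" if "j \<in> {1..m}" "k \<in> N" for j k
    using block_iff[OF hN[OF that(1)] that(2)] that(1) by (simp add: I_def)
  have IN: "I j \<subseteq> N" if "j \<le> m" for j
    using block_subset[OF hN[of j]] that by (auto simp: I_def R_def)
  have distinct: "block_centre p \<noteq> block_centre q"
    if "i \<le> m" "j \<le> m" "i \<noteq> j" "p \<in> I i" "q \<in> I j" for i j p q
  proof -
    have pq: "p \<in> N" "q \<in> N" using IN that by blast+
    have c: "block_centre k \<notin> J" if "k \<in> I 0" for k using that by (simp add: I_def R_def)
    consider "i = 0" "j \<in> {1..m}" | "j = 0" "i \<in> {1..m}" | "i \<in> {1..m}" "j \<in> {1..m}"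
      using \<open>i \<le> m\<close> \<open>j \<le> m\<close> \<open>i \<noteq> j\<close> by (cases "i = 0"; cases "j = 0") auto
    then show ?thesis
    proof cases
      case 1
      then show ?thesis using c[of p] that Iiff[of j q] pq hJ[of j] by auto
    next
      case 2
      then show ?thesis using c[of q] that Iiff[of i p] pq hJ[of i] by auto
    next
      case 3
      have "h i \<noteq> h j" using h 3 \<open>i \<noteq> j\<close> by (auto simp: bij_betw_def dest: inj_onD)
      then show ?thesis using Iiff[OF 3(1) pq(1)] Iiff[OF 3(2) pq(2)] that by auto
    qed
  qed
  have disj: "disjoint_family_on I {0..m}"
    unfolding disjoint_family_on_def using distinct by fastforce
  have union: "(\<Union>j\<in>{0..m}. I j) = N"
  proof
    show "(\<Union>j\<in>{0..m}. I j) \<subseteq> N" using IN by (intro UN_least) simp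
    show "N \<subseteq> (\<Union>j\<in>{0..m}. I j)"
    proof
      fix k assume k: "k \<in> N"
      show "k \<in> (\<Union>j\<in>{0..m}. I j)"
      proof (cases "block_centre k \<in> J")
        case True
        then obtain j where "j \<in> {1..m}" "h j = block_centre k" using h by (auto simp: bij_betw_def)
        then show ?thesis using Iiff[of j k] k by (intro UN_I[of j]) auto
      next
        case False
        then show ?thesis using k by (intro UN_I[of 0]) (auto simp: I_def R_def)
      qed
    qed
  qed
  have orth: "switched p \<bullet> switched q = 0" if "i \<le> m" "j \<le> m" "i \<noteq> j" "p \<in> I i" "q \<in> I j" for i j p q
    using block_orthogonal[OF _ _ distinct[OF that]] IN that by blast
  have R_centre: "block_centre k = k" if "k \<in> R" for k
    using that by (auto simp: R_def block_centre_def J_def)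
  have R_orth: "switched p \<bullet> switched q = 0" if "p \<in> R" "q \<in> R" "p \<noteq> q" for p q
  proof (rule block_orthogonal)
    show "p \<in> N" "q \<in> N" using that(1,2) by (simp_all add: R_def)
    show "block_centre p \<noteq> block_centre q" using R_centre that by metis
  qed
  have dec: "orthogonal_decomposition m V"
    unfolding orthogonal_decomposition_def
  proof (intro conjI allI impI ballI)
    show "subspace (V i)" for i by (simp add: V_def)
    show "orthogonal u w" if "i \<le> m" "j \<le> m" "i \<noteq> j" "u \<in> V i" "w \<in> V j" for i j u w
    proof (rule orthogonal_spans)
      show "u \<in> span (switched ` I i)" "w \<in> span (switched ` I j)" using that by (simp_all add: V_def)
      show "x \<bullet> y = 0" if "x \<in> switched ` I i" "y \<in> switched ` I j" for x y
        using orth[OF \<open>i \<le> m\<close> \<open>j \<le> m\<close> \<open>i \<noteq> j\<close>] that by auto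
    qed
    fix u :: 'a
    obtain w where w: "frame_op w = u" using frame_op_surj by blast
    define f where "f j = (\<Sum>k\<in>I j. (switched k \<bullet> w) *\<^sub>R switched k)" for j
    have "u = (\<Sum>k\<in>(\<Union>j\<in>{0..m}. I j). (switched k \<bullet> w) *\<^sub>R switched k)"
      using w by (simp add: union frame_op_switched)
    also have "\<dots> = (\<Sum>j\<in>{0..m}. f j)"
      unfolding f_def
    proof (rule sum.UNION_disjoint)
      show "\<forall>i\<in>{0..m}. finite (I i)"
        using finite_subset[OF IN finite_N] by simp
      show "\<forall>i\<in>{0..m}. \<forall>j\<in>{0..m}. i \<noteq> j \<longrightarrow> I i \<inter> I j = {}"
        using disj by (auto simp: disjoint_family_on_def)
    qed simp
    finally have "u = (\<Sum>i\<le>m. f i)" by (simp add: atMost_atLeast0)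
    moreover have "f i \<in> V i" for i
      unfolding f_def V_def by (intro span_sum span_scale span_base imageI)
    ultimately show "\<exists>f. (\<forall>i\<le>m. f i \<in> V i) \<and> u = (\<Sum>i\<le>m. f i)" by blast
  qed
  have blockI: "I j = block (h j)" "V j = span (switched ` block (h j))" if "j \<in> {1..m}" for j
    using that by (simp_all add: I_def V_def)
  note simplex = simplex_block[OF hJ[unfolded J_def]]
  show thesis
  proof (rule that[of V I], unfold J_def[symmetric] m_def[symmetric])
    show "orthogonal_decomposition m V" by (rule dec)
    show "disjoint_family_on I {0..m}" by (rule disj)
    show "(\<Union>j\<in>{0..m}. I j) = N" by (rule union)
    show "dim (V j) > 0 \<and> even (dim (V j))" if "j \<in> {1..m}" for j
      using simplex(3-5)[OF that] blockI[OF that] by simp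
    show "centered_regular_simplex_vertices (V j) (switched ` I j)" if "j \<in> {1..m}" for j
      using simplex(2)[OF that] blockI[OF that] by simp
    show "inj_on switched (I j)" if "j \<in> {0..m}" for j
    proof (cases "j = 0")
      case True
      show ?thesis
      proof (rule inj_onI, rule ccontr)
        fix p q assume pq: "p \<in> I j" "q \<in> I j" "switched p = switched q" "p \<noteq> q"
        then have "switched p \<bullet> switched p = 0" using R_orth[of p q] True by (simp add: I_def)
        then show False using switched_inner_self[of p] pq True by (simp add: I_def R_def)
      qed
    next
      case False
      then have "j \<in> {1..m}" using that by auto
      then show ?thesis using simplex(1) blockI by simp
    qed
    show "orthonormal_basis_of (V 0) (switched ` I 0)"
      unfolding orthonormal_basis_of_def
    proof (intro conjI ballI)
      show "pairwise orthogonal (switched ` I 0)"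
        using R_orth by (auto simp: pairwise_def orthogonal_def I_def)
      show "norm u = 1" if "u \<in> switched ` I 0" for u
        using that norm_switched by (auto simp: I_def R_def)
    qed (simp add: V_def)
  qed
qed

end

theorem theorem3:
  fixes v :: "nat \<Rightarrow> real ^ 'd" and n :: nat
  assumes "n \<ge> CARD('d)"
    and "\<And>i. i \<in> {1..n} \<Longrightarrow> norm (v i) = 1"
    and "\<And>\<epsilon> :: nat \<Rightarrow> real. (\<forall>i\<in>{1..n}. \<epsilon> i \<in> {-1, 1}) \<Longrightarrow>
           norm (\<Sum>i=1..n. \<epsilon> i *\<^sub>R v i) \<le> sqrt (2 * real n - real CARD('d))"
  shows "\<exists>(\<sigma> :: nat \<Rightarrow> real) (V :: nat \<Rightarrow> (real ^ 'd) set) (I :: nat \<Rightarrow> nat set).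
           (\<forall>i\<in>{1..n}. \<sigma> i \<in> {-1, 1}) \<and>
           orthogonal_decomposition (n - CARD('d)) V \<and>
           (\<forall>j\<in>{1..n - CARD('d)}. dim (V j) > 0 \<and> even (dim (V j))) \<and>
           disjoint_family_on I {0..n - CARD('d)} \<and>
           (\<Union>j\<in>{0..n - CARD('d)}. I j) = {1..n} \<and>
           (\<forall>j\<in>{0..n - CARD('d)}. inj_on (\<lambda>i. \<sigma> i *\<^sub>R v i) (I j)) \<and>
           orthonormal_basis_of (V 0) ((\<lambda>i. \<sigma> i *\<^sub>R v i) ` I 0) \<and>
           (\<forall>j\<in>{1..n - CARD('d)}.
              centered_regular_simplex_vertices (V j) ((\<lambda>i. \<sigma> i *\<^sub>R v i) ` I j))"
proof -
  interpret bounded_signed_sums v "{1..n}"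
  proof
    fix \<epsilon> :: "nat \<Rightarrow> real" assume "\<forall>i\<in>{1..n}. \<epsilon> i \<in> {-1, 1}"
    from assms(3)[OF this]
    have "(norm (\<Sum>i=1..n. \<epsilon> i *\<^sub>R v i))\<^sup>2 \<le> (sqrt (2 * real n - real CARD('d)))\<^sup>2"
      by (intro power_mono) auto
    also have "\<dots> = 2 * real n - real CARD('d)"
      using assms(1) by (intro real_sqrt_pow2) simp
    finally show "(norm (\<Sum>i\<in>{1..n}. \<epsilon> i *\<^sub>R v i))\<^sup>2 \<le> 2 * real (card {1..n}) - real (DIM(real ^ 'd))"
      by simp
  qed (use assms(2) in auto)
  obtain B \<sigma> where B: "pairwise orthogonal B" "\<forall>e\<in>B. norm e = 1" "UNIV \<subseteq> span B"
    "\<forall>e\<in>B. frame_op e = \<sigma> e *\<^sub>R e"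
    using self_adjoint_orthonormal_eigenbasis_subspace[OF linear_frame_op frame_op_self_adjoint, of UNIV]
    by auto
  interpret bounded_signed_sums_eigen v "{1..n}" B \<sigma>
    by unfold_locales (use B in auto)
  obtain z s \<pi> y where star: "section_vertex tight_space z" "\<And>k. k \<in> {1..n} \<Longrightarrow> s k \<in> {-1, 1}"
    "\<And>i. i \<in> active z \<Longrightarrow> \<pi> i \<in> {1..n} - active z" "\<And>i. i \<in> active z \<Longrightarrow> swap_vector s i (\<pi> i) (y i)"
    using exists_swap_star by blast
  interpret swap_star v "{1..n}" B \<sigma> z s \<pi> y
    by unfold_locales (use star in blast)+
  have m: "card (\<pi> ` active z) = n - CARD('d)"
    using card_centres assms(1) by simp
  have switched: "switched = (\<lambda>i. s i *\<^sub>R v i)" by (simp add: fun_eq_iff switched_def)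
  show ?thesis
  proof (rule simplex_decomposition[unfolded m switched])
    fix V :: "nat \<Rightarrow> (real ^ 'd) set" and I :: "nat \<Rightarrow> nat set"
    assume *: "orthogonal_decomposition (n - CARD('d)) V"
      "\<And>j. j \<in> {1..n - CARD('d)} \<Longrightarrow> dim (V j) > 0 \<and> even (dim (V j))"
      "disjoint_family_on I {0..n - CARD('d)}"
      "(\<Union>j\<in>{0..n - CARD('d)}. I j) = {1..n}"
      "\<And>j. j \<in> {0..n - CARD('d)} \<Longrightarrow> inj_on (\<lambda>i. s i *\<^sub>R v i) (I j)"
      "orthonormal_basis_of (V 0) ((\<lambda>i. s i *\<^sub>R v i) ` I 0)"
      "\<And>j. j \<in> {1..n - CARD('d)} \<Longrightarrow> centered_regular_simplex_vertices (V j) ((\<lambda>i. s i *\<^sub>R v i) ` I j)"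
    show ?thesis
      using star(2) * by (intro exI[of _ s] exI[of _ V] exI[of _ I]) blast
  qed
qed

end
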